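(* The system of the eigenfunctions $\varphi(x,\lambda_n)$ ($n\in\mathbb{Z}$) of the boundary value problem $By'+\Omega(x)y=\lambda\rho(x)y$, $0<x<\pi$, $U_1(y)=0$, $U_2(y)=0$ described in the context is complete in $L_{2,\rho}(0,\pi;\mathbb{C}^2)\oplus\mathbb{C}^2$. Here $\varphi(x,\lambda_n)$ is regarded as an element of this space by means of the identification given in the context.
   Context: Let $0<a<\pi$, $\alpha>0$, $\alpha\neq1$, $\rho(x)=1$ for $0\le x\le a$ and $\rho(x)=\alpha$ for $a<x\le\pi$. Let $p,q\in L_2(0,\pi)$ be real-valued, and $$B=\begin{pmatrix}0&1\\ -1&0\end{pmatrix},\quad \Omega(x)=\begin{pmatrix}p(x)&q(x)\\ q(x)&-p(x)\end{pmatrix},\quad y(x)=\begin{pmatrix}y_1(x)\\ y_2(x)\end{pmatrix}.$$ Let $b_1,\dots,b_4,c_1,\dots,c_4$ be real numbers with $k_1:=b_1b_4-b_2b_3>0$ and $k_2:=c_1c_4-c_2c_3>0$. Consider the boundary value problem consisting of the system $By'+\Omega(x)y=\lambda\rho(x)y$, $0<x<\pi$ ($\lambda\in\mathbb{C}$ the spectral parameter), and the boundary conditions $$U_1(y):=b_1y_2(0)+b_2y_1(0)-\lambda(b_3y_2(0)+b_4y_1(0))=0,$$ $$U_2(y):=c_1y_2(\pi)+c_2y_1(\pi)+\lambda(c_3y_2(\pi)+c_4y_1(\pi))=0.$$ Let $\varphi(x,\lambda)=(\varphi_1,\varphi_2)^T$ be the solution of the system with $\varphi(0,\lambda)=(\lambda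 b_3-b_1,\ b_2-\lambda b_4)^T$. The eigenvalues of the problem (the $\lambda$ for which it has a nonzero solution) are real and are denoted $\lambda_n$, $n\in\mathbb{Z}$; $\varphi(x,\lambda_n)$ is an eigenfunction for $\lambda_n$. The Hilbert space $L_{2,\rho}(0,\pi;\mathbb{C}^2)\oplus\mathbb{C}^2$ consists of $Y=(y_1(x),y_2(x),y_3,y_4)^T$ with inner product $$\langle Y,Z\rangle=\int_0^\pi\{y_1\overline{z_1}+y_2\overline{z_2}\}\rho(x)\,dx+\frac1{k_1}y_3\overline{z_3}+\frac1{k_2}y_4\overline{z_4}.$$ The eigenfunction $\varphi(x,\lambda_n)$ is identified with the element $$\bigl(\varphi_1(x,\lambda_n),\ \varphi_2(x,\lambda_n),\ b_3\varphi_2(0,\lambda_n)+b_4\varphi_1(0,\lambda_n),\ c_3\varphi_2(\pi,\lambda_n)+c_4\varphi_1(\pi,\lambda_n)\bigr)^T.$$ A system is complete if the only element orthogonal to all its members is zero. *)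

theory Defs
  imports "HOL-Analysis.Analysis"
begin

definition rho :: "real \<Rightarrow> real \<Rightarrow> real \<Rightarrow> real" where
  "rho a \<alpha> x = (if x \<le> a then 1 else \<alpha>)"

definition B_mat :: "complex^2^2" where
  "B_mat = vector [vector [0, 1], vector [- 1, 0]]"

definition Omega :: "(real \<Rightarrow> real) \<Rightarrow> (real \<Rightarrow> real) \<Rightarrow> real \<Rightarrow> complex^2^2" where
  "Omega p q x = vector [vector [complex_of_real (p x), complex_of_real (q x)],
                         vector [complex_of_real (q x), - complex_of_real (p x)]]"

definition in_L2 :: "(real \<Rightarrow> real) \<Rightarrow> bool" where
  "in_L2 f \<longleftrightarrow> f \<in> borel_measurable (lebesgue_on {0<..<pi}) \<and>
     integrable (lebesgue_on {0<..<pi}) (\<lambda>x. (f x)\<^sup>2)"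

(* y is absolutely continuous on [0, pi], i.e. an indefinite Lebesgue integral, and y' is its
   derivative (determined up to null sets).  Values of y outside [0, pi] play no role. *)
definition has_ac_derivative :: "(real \<Rightarrow> complex^2) \<Rightarrow> (real \<Rightarrow> complex^2) \<Rightarrow> bool" where
  "has_ac_derivative y y' \<longleftrightarrow> integrable (lebesgue_on {0..pi}) y' \<and>
     (\<forall>x\<in>{0..pi}. y x = y 0 + (LINT t|lebesgue_on {0..x}. y' t))"

(* Since p and q are only square integrable and rho jumps at a, the system is required to hold
   almost everywhere. *)
definition is_solution ::
  "real \<Rightarrow> real \<Rightarrow> (real \<Rightarrow> real) \<Rightarrow> (real \<Rightarrow> real) \<Rightarrow> complex \<Rightarrow> (real \<Rightarrow> complex^2) \<Rightarrow> bool" where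
  "is_solution a \<alpha> p q \<mu> y \<longleftrightarrow>
     (\<exists>y'. has_ac_derivative y y' \<and>
        (AE x in lebesgue_on {0<..<pi}.
           B_mat *v y' x + Omega p q x *v y x = (\<mu> * complex_of_real (rho a \<alpha> x)) *s y x))"

definition U1 ::
  "real \<Rightarrow> real \<Rightarrow> real \<Rightarrow> real \<Rightarrow> complex \<Rightarrow> (real \<Rightarrow> complex^2) \<Rightarrow> complex" where
  "U1 b1 b2 b3 b4 \<mu> y =
     complex_of_real b1 * y 0 $ 2 + complex_of_real b2 * y 0 $ 1
     - \<mu> * (complex_of_real b3 * y 0 $ 2 + complex_of_real b4 * y 0 $ 1)"

definition U2 ::
  "real \<Rightarrow> real \<Rightarrow> real \<Rightarrow> real \<Rightarrow> complex \<Rightarrow> (real \<Rightarrow> complex^2) \<Rightarrow> complex" where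
  "U2 c1 c2 c3 c4 \<mu> y =
     complex_of_real c1 * y pi $ 2 + complex_of_real c2 * y pi $ 1
     + \<mu> * (complex_of_real c3 * y pi $ 2 + complex_of_real c4 * y pi $ 1)"

definition is_eigenvalue ::
  "real \<Rightarrow> real \<Rightarrow> (real \<Rightarrow> real) \<Rightarrow> (real \<Rightarrow> real) \<Rightarrow> real \<Rightarrow> real \<Rightarrow> real \<Rightarrow> real \<Rightarrow>
   real \<Rightarrow> real \<Rightarrow> real \<Rightarrow> real \<Rightarrow> complex \<Rightarrow> bool" where
  "is_eigenvalue a \<alpha> p q b1 b2 b3 b4 c1 c2 c3 c4 \<mu> \<longleftrightarrow>
     (\<exists>y. is_solution a \<alpha> p q \<mu> y \<and> U1 b1 b2 b3 b4 \<mu> y = 0 \<and> U2 c1 c2 c3 c4 \<mu> y = 0 \<and>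
          (\<exists>x\<in>{0..pi}. y x \<noteq> 0))"

(* Representatives of elements of the Hilbert space: (y1, y2) as a vector function, then y3, y4.
   The almost-everywhere quotient is taken care of by hspace_zero. *)
type_synonym helem = "(real \<Rightarrow> complex^2) \<times> complex \<times> complex"

(* norm is the Euclidean norm on complex^2, so (norm (y x))^2 = |y1 x|^2 + |y2 x|^2. *)
definition hspace :: "real \<Rightarrow> real \<Rightarrow> helem set" where
  "hspace a \<alpha> = {(y, y3, y4) | y y3 y4.
     y \<in> borel_measurable (lebesgue_on {0<..<pi}) \<and>
     integrable (lebesgue_on {0<..<pi}) (\<lambda>x. (norm (y x))\<^sup>2 * rho a \<alpha> x)}"

fun hspace_inner :: "real \<Rightarrow> real \<Rightarrow> real \<Rightarrow> real \<Rightarrow> helem \<Rightarrow> helem \<Rightarrow> complex" where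
  "hspace_inner a \<alpha> k1 k2 (y, y3, y4) (z, z3, z4) =
     (LINT x|lebesgue_on {0<..<pi}.
        (y x $ 1 * cnj (z x $ 1) + y x $ 2 * cnj (z x $ 2)) * complex_of_real (rho a \<alpha> x))
     + 1 / complex_of_real k1 * y3 * cnj z3 + 1 / complex_of_real k2 * y4 * cnj z4"

fun hspace_zero :: "helem \<Rightarrow> bool" where
  "hspace_zero (y, y3, y4) \<longleftrightarrow> (AE x in lebesgue_on {0<..<pi}. y x = 0) \<and> y3 = 0 \<and> y4 = 0"

definition complete_system ::
  "real \<Rightarrow> real \<Rightarrow> real \<Rightarrow> real \<Rightarrow> ('i \<Rightarrow> helem) \<Rightarrow> bool" where
  "complete_system a \<alpha> k1 k2 e \<longleftrightarrow>
     (\<forall>n. e n \<in> hspace a \<alpha>) \<and>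
     (\<forall>Z\<in>hspace a \<alpha>. (\<forall>n. hspace_inner a \<alpha> k1 k2 Z (e n) = 0) \<longrightarrow> hspace_zero Z)"

definition to_hspace ::
  "real \<Rightarrow> real \<Rightarrow> real \<Rightarrow> real \<Rightarrow> (real \<Rightarrow> complex^2) \<Rightarrow> helem" where
  "to_hspace b3 b4 c3 c4 y =
     (y, complex_of_real b3 * y 0 $ 2 + complex_of_real b4 * y 0 $ 1,
         complex_of_real c3 * y pi $ 2 + complex_of_real c4 * y pi $ 1)"

end

theory Submission
  imports Defs "HOL-Complex_Analysis.Conformal_Mappings"
begin

text \<open>
  The two extra components absorb the spectral parameter in the boundary conditions: the problem
  is the eigenvalue problem of a symmetric operator \<open>L\<close> that sends \<open>Y = (y, y3, y4)\<close>, with \<open>y3\<close> and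
  \<open>y4\<close> tied to the boundary values of \<open>y\<close>, to
  \<open>((B y' + \<Omega> y) / \<rho>, b1 y2(0) + b2 y1(0), - c1 y2(\<pi>) - c2 y1(\<pi>))\<close>.
  Symmetry is the Lagrange identity for the differential expression, where the boundary terms cancel
  because the weights \<open>1/k1\<close> and \<open>1/k2\<close> are the right ones (\<open>green_identity\<close>).  It yields the resolvent
  estimate \<open>\<parallel>(L - \<mu>)\<^sup>-\<^sup>1 Z\<parallel> \<le> \<parallel>Z\<parallel> / \<bar>Im \<mu>\<bar>\<close> (\<open>resolvent_bound\<close>), and in particular real eigenvalues.

  Let \<open>Z\<close> be orthogonal to all eigenfunctions.  Then the resolvent applied to \<open>Z\<close> has no poles, and an
  entire function bounded by \<open>K / \<bar>Im \<mu>\<bar>\<close> is zero (\<open>entire_eq_0_of_imaginary_bound\<close>): multiplied by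
  \<open>\<mu>\<^sup>2 - R\<^sup>2\<close>, whose modulus on the circle of radius \<open>R\<close> is \<open>2 R \<bar>Im \<mu>\<bar>\<close>, it is at most \<open>2 R K\<close> on the whole
  disc.  So \<open>(L - \<mu>)\<^sup>-\<^sup>1 Z = 0\<close>, which forces \<open>Z = 0\<close>.

  To make this concrete, write the resolvent as \<open>Y(\<mu>) = w(\<mu>) + C(\<mu>) \<phi>(\<mu>)\<close>.  Here \<open>w(\<mu>)\<close> solves the
  inhomogeneous system with a constant initial value, chosen such that the first boundary condition
  holds for every \<open>\<mu>\<close> and the third component vanishes; \<open>C(\<mu>)\<close> is fixed by the second boundary
  condition.  The third component of \<open>\<phi>(\<mu>)\<close> is the constant \<open>-k1\<close>, so that of \<open>Y(\<mu>)\<close> is \<open>-k1 C(\<mu>)\<close>, and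
  the resolvent estimate bounds the scalar function \<open>C\<close>.  Near an eigenvalue \<open>\<kappa>\<close>, symmetry and
  \<open>Z \<bottom> \<phi>(\<kappa>)\<close> give \<open>Y(\<mu>) \<bottom> \<phi>(\<kappa>)\<close>, that is
  \<open>C(\<mu>) = - \<langle>w(\<mu>), \<phi>(\<kappa>)\<rangle> / \<langle>\<phi>(\<mu>), \<phi>(\<kappa>)\<rangle>\<close> with a denominator that does not vanish near \<open>\<kappa>\<close>.  Hence \<open>C\<close> is
  entire, so \<open>C = 0\<close> and \<open>Y = w\<close>.  The indefinite integrals of \<open>w(\<mu>)\<close> are entire in \<open>\<mu>\<close> and satisfy
  the same kind of bound, so \<open>w = 0\<close>, and the inhomogeneous equation shows \<open>Z = 0\<close>.

  The coefficients \<open>p\<close>, \<open>q\<close> are only square integrable, so solutions are absolutely continuous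
  functions.  The calculus needed for them, existence of solutions of Volterra equations, Gronwall's
  inequality and holomorphic dependence on \<open>\<mu>\<close> (\<open>parameter_derivative\<close>) come first.
\<close>

section \<open>Indefinite Lebesgue integrals\<close>

lemma integrable_on_of_abs:
  fixes f :: "real \<Rightarrow> 'a::euclidean_space"
  shows "f absolutely_integrable_on S \<Longrightarrow> f integrable_on S"
  by (rule set_lebesgue_integral_eq_integral(1))

lemma absolutely_integrable_on_Icc_subset:
  fixes f :: "real \<Rightarrow> 'a::euclidean_space"
  assumes "f absolutely_integrable_on {a..b}" "x \<in> {a..b}" "y \<in> {a..b}"
  shows "f absolutely_integrable_on {x..y}"
  using absolutely_integrable_on_subinterval[OF assms(1)] assms by simp

lemma integral_increment:
  fixes f :: "real \<Rightarrow> 'a::euclidean_space"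
  assumes "f absolutely_integrable_on {a..b}" "x \<in> {a..b}" "y \<in> {a..b}" "x \<le> y"
  shows "integral {a..y} f - integral {a..x} f = integral {x..y} f"
  using Henstock_Kurzweil_Integration.integral_combine[of a x y f] assms
  by (smt (verit) absolutely_integrable_on_subinterval add_diff_cancel_left' atLeastAtMost_iff
      atLeastatMost_subset_iff set_lebesgue_integral_eq_integral(1))

lemma continuous_on_indefinite_integral:
  fixes f :: "real \<Rightarrow> 'a::euclidean_space"
  assumes "f absolutely_integrable_on {a..b}"
  shows "continuous_on {a..b} (\<lambda>x. integral {a..x} f)"
  by (rule indefinite_integral_continuous_1[OF integrable_on_of_abs[OF assms]])

lemma absolutely_integrable_minus:
  fixes f :: "real \<Rightarrow> 'a::euclidean_space"
  assumes "f absolutely_integrable_on S"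
  shows "(\<lambda>t. - f t) absolutely_integrable_on S"
  using absolutely_integrable_scaleR_left[OF assms, of "-1"] by simp

lemma absolutely_integrable_cnj:
  fixes f :: "real \<Rightarrow> complex"
  assumes "f absolutely_integrable_on S"
  shows "(\<lambda>t. cnj (f t)) absolutely_integrable_on S"
  using absolutely_integrable_linear[OF assms bounded_linear_cnj] by (simp add: o_def)

lemma absolutely_integrable_continuous_mult:
  fixes f g :: "real \<Rightarrow> 'a::{euclidean_space,real_normed_algebra}"
  assumes "continuous_on {a..b} f" "g absolutely_integrable_on {a..b}"
  shows "(\<lambda>x. f x * g x) absolutely_integrable_on {a..b}"
proof (rule absolutely_integrable_bounded_measurable_product[where h = "(*)"])
  show "f \<in> borel_measurable (lebesgue_on {a..b})"
    by (intro continuous_imp_measurable_on_sets_lebesgue assms) auto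
  show "bounded (f ` {a..b})"
    using assms by (intro compact_imp_bounded compact_continuous_image) auto
qed (use assms bilinear_conv_bounded_bilinear bounded_bilinear_mult in auto)

lemma absolutely_integrable_mult_continuous:
  fixes f g :: "real \<Rightarrow> 'a::{euclidean_space,real_normed_algebra}"
  assumes "continuous_on {a..b} f" "g absolutely_integrable_on {a..b}"
  shows "(\<lambda>x. g x * f x) absolutely_integrable_on {a..b}"
proof (rule absolutely_integrable_bounded_measurable_product[where h = "\<lambda>x y. y * x"])
  show "f \<in> borel_measurable (lebesgue_on {a..b})"
    by (intro continuous_imp_measurable_on_sets_lebesgue assms) auto
  show "bounded (f ` {a..b})"
    using assms by (intro compact_imp_bounded compact_continuous_image) auto
  show "bilinear (\<lambda>x y :: 'a. y * x)"
    using bounded_bilinear.flip[OF bounded_bilinear_mult] bilinear_conv_bounded_bilinear by blast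
qed (use assms in auto)

lemma uniform_modulus_on_Icc:
  fixes f :: "real \<Rightarrow> 'a::real_normed_vector"
  assumes "continuous_on {a..b} f" "e > 0"
  obtains d where "d > 0" "\<And>x y. x \<in> {a..b} \<Longrightarrow> y \<in> {a..b} \<Longrightarrow> \<bar>y - x\<bar> \<le> d \<Longrightarrow> norm (f y - f x) \<le> e"
proof -
  have "uniformly_continuous_on {a..b} f"
    using assms(1) by (rule compact_uniformly_continuous) simp
  then obtain d where d: "d > 0" "\<forall>x\<in>{a..b}. \<forall>y\<in>{a..b}. dist y x < d \<longrightarrow> dist (f y) (f x) < e"
    using assms(2) unfolding uniformly_continuous_on_def by blast
  show thesis
  proof (rule that[of "d/2"])
    fix x y assume "x \<in> {a..b}" "y \<in> {a..b}" "\<bar>y - x\<bar> \<le> d/2"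
    then have "dist (f y) (f x) < e"
      using d by (auto simp: dist_real_def)
    then show "norm (f y - f x) \<le> e"
      by (simp add: dist_norm)
  qed (use d in simp)
qed

text \<open>A substitute for "derivative zero almost everywhere": summing over a fine partition bounds the total
  increment by an arbitrarily small multiple of the total increment of \<open>V\<close>.  For an absolutely
  continuous \<open>E\<close> one takes for \<open>V\<close> the indefinite integral of a dominating function.\<close>

lemma constant_of_small_increments:
  fixes E :: "real \<Rightarrow> 'a::real_normed_vector" and V :: "real \<Rightarrow> real"
  assumes small: "\<And>e. e > 0 \<Longrightarrow> \<exists>d>0. \<forall>x\<in>{a..b}. \<forall>y\<in>{a..b}. x \<le> y \<longrightarrow> y \<le> x + d \<longrightarrow>
                    norm (E y - E x) \<le> e * (V y - V x)"
    and x: "x \<in> {a..b}"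
  shows "E x = E a"
proof -
  have bound: "norm (E x - E a) \<le> e * (V x - V a)" if e: "e > 0" for e
  proof -
    obtain d where "d > 0" and d: "\<And>x y. x \<in> {a..b} \<Longrightarrow> y \<in> {a..b} \<Longrightarrow> x \<le> y \<Longrightarrow> y \<le> x + d \<Longrightarrow>
        norm (E y - E x) \<le> e * (V y - V x)"
      using small[OF e] by meson
    \<comment> \<open>Walk from \<open>a\<close> in steps of length \<open>d\<close>.\<close>
    have step: "\<forall>x\<in>{a..b}. x \<le> a + real n * d \<longrightarrow> norm (E x - E a) \<le> e * (V x - V a)" for n
    proof (induction n)
      case 0
      then show ?case by auto
    next
      case (Suc n)
      show ?case
      proof (intro ballI impI)
        fix x assume x: "x \<in> {a..b}" "x \<le> a + real (Suc n) * d"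
        define u where "u = max a (x - d)"
        have u: "u \<in> {a..b}" "u \<le> x" "x \<le> u + d" "u \<le> a + real n * d"
          using x \<open>d > 0\<close> by (auto simp: u_def algebra_simps)
        have "norm (E x - E a) \<le> norm (E x - E u) + norm (E u - E a)"
          using norm_triangle_ineq[of "E x - E u" "E u - E a"] by simp
        also have "\<dots> \<le> e * (V x - V u) + e * (V u - V a)"
          using d[OF u(1) x(1) u(2) u(3)] Suc u by (intro add_mono) auto
        finally show "norm (E x - E a) \<le> e * (V x - V a)"
          by (simp add: algebra_simps)
      qed
    qed
    obtain n where "(x - a) / d < real n"
      using reals_Archimedean2 by blast
    then have "x \<le> a + real n * d"
      using \<open>d > 0\<close> by (simp add: field_simps)
    then show ?thesis
      using step x by blast
  qed
  have "V x - V a \<ge> 0"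
    using order_trans[OF norm_ge_zero bound[of 1]] by simp
  have "norm (E x - E a) \<le> 0 + e" if "e > 0" for e
  proof -
    have "norm (E x - E a) \<le> e / (V x - V a + 1) * (V x - V a)"
      using \<open>V x - V a \<ge> 0\<close> that by (intro bound) auto
    also have "\<dots> \<le> e"
      using \<open>V x - V a \<ge> 0\<close> that by (simp add: field_simps)
    finally show ?thesis by simp
  qed
  then have "norm (E x - E a) \<le> 0"
    by (rule field_le_epsilon)
  then show ?thesis by simp
qed

text \<open>On a short interval \<open>[x, y]\<close> the defect of the product rule is the integral of
  \<open>f' (g(x) - g) + (f(y) - f) g'\<close>, which uniform continuity makes small relative to the integral of
  \<open>\<bar>f'\<bar> + \<bar>g'\<bar>\<close>.\<close>

lemma integral_product_rule:
  fixes f g f' g' :: "real \<Rightarrow> complex"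
  assumes f': "f' absolutely_integrable_on {a..b}" and g': "g' absolutely_integrable_on {a..b}"
    and f: "\<And>x. x \<in> {a..b} \<Longrightarrow> f x = f a + integral {a..x} f'"
    and g: "\<And>x. x \<in> {a..b} \<Longrightarrow> g x = g a + integral {a..x} g'"
    and x: "x \<in> {a..b}"
  shows "integral {a..x} (\<lambda>t. f' t * g t + f t * g' t) = f x * g x - f a * g a"
proof -
  have cf: "continuous_on {a..b} f"
    using continuous_on_indefinite_integral[OF f'] f
    by (subst continuous_on_cong[OF refl f]) (auto intro!: continuous_intros)
  have cg: "continuous_on {a..b} g"
    using continuous_on_indefinite_integral[OF g'] g
    by (subst continuous_on_cong[OF refl g]) (auto intro!: continuous_intros)
  let ?h = "\<lambda>t. f' t * g t + f t * g' t"
  let ?n = "\<lambda>t. norm (f' t) + norm (g' t)"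
  have h: "?h absolutely_integrable_on {a..b}"
    by (intro set_integral_add absolutely_integrable_mult_continuous
        absolutely_integrable_continuous_mult cf cg f' g')
  have n: "?n absolutely_integrable_on {a..b}"
    by (intro set_integral_add absolutely_integrable_norm[unfolded o_def] f' g')
  define E where "E x = f x * g x - integral {a..x} ?h" for x
  have "E x = E a"
  proof (rule constant_of_small_increments[where V = "\<lambda>x. integral {a..x} ?n", OF _ x])
    fix e :: real assume "e > 0"
    obtain d1 where d1: "d1 > 0"
        "\<And>x y. x \<in> {a..b} \<Longrightarrow> y \<in> {a..b} \<Longrightarrow> \<bar>y - x\<bar> \<le> d1 \<Longrightarrow> norm (f y - f x) \<le> e"
      using uniform_modulus_on_Icc[OF cf \<open>e > 0\<close>] by blast
    obtain d2 where d2: "d2 > 0"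
        "\<And>x y. x \<in> {a..b} \<Longrightarrow> y \<in> {a..b} \<Longrightarrow> \<bar>y - x\<bar> \<le> d2 \<Longrightarrow> norm (g y - g x) \<le> e"
      using uniform_modulus_on_Icc[OF cg \<open>e > 0\<close>] by blast
    define d where "d = min d1 d2"
    have d: "d > 0" "d \<le> d1" "d \<le> d2"
      using d1(1) d2(1) by (auto simp: d_def)
    show "\<exists>d>0. \<forall>x\<in>{a..b}. \<forall>y\<in>{a..b}. x \<le> y \<longrightarrow> y \<le> x + d \<longrightarrow>
            norm (E y - E x) \<le> e * (integral {a..y} ?n - integral {a..x} ?n)"
    proof (rule exI[of _ d], intro conjI ballI impI)
      fix x y assume xy: "x \<in> {a..b}" "y \<in> {a..b}" "x \<le> y" "y \<le> x + d"
      have sub: "k absolutely_integrable_on {x..y}" if "k absolutely_integrable_on {a..b}" for k :: "real \<Rightarrow> complex"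
        using absolutely_integrable_on_Icc_subset[OF that xy(1,2)] .
      have cf': "continuous_on {x..y} f" and cg': "continuous_on {x..y} g"
        using xy by (auto intro: continuous_on_subset[OF cf] continuous_on_subset[OF cg])
      let ?k = "\<lambda>t. f' t * (g x - g t) + (f y - f t) * g' t"
      have k: "?k absolutely_integrable_on {x..y}"
        by (intro set_integral_add absolutely_integrable_mult_continuous
            absolutely_integrable_continuous_mult continuous_intros cf' cg' sub f' g')
      have fi: "integral {x..y} f' = f y - f x" "integral {x..y} g' = g y - g x"
        using integral_increment[OF f' xy(1-3)] integral_increment[OF g' xy(1-3)]
          f[OF xy(1)] f[OF xy(2)] g[OF xy(1)] g[OF xy(2)] by auto
      have "integral {x..y} ?k = integral {x..y} (\<lambda>t. (f' t * g x + f y * g' t) - ?h t)"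
        by (simp add: algebra_simps)
      also have "\<dots> = integral {x..y} (\<lambda>t. f' t * g x + f y * g' t) - integral {x..y} ?h"
        by (intro Henstock_Kurzweil_Integration.integral_diff integrable_on_of_abs sub h)
          (intro set_integral_add set_integrable_mult_left set_integrable_mult_right f' g' impI)
      also have "integral {x..y} (\<lambda>t. f' t * g x + f y * g' t) = (f y - f x) * g x + f y * (g y - g x)"
        by (subst Henstock_Kurzweil_Integration.integral_add)
          (auto intro!: integrable_on_of_abs sub f' g' simp: fi)
      finally have "integral {x..y} ?k = E y - E x"
        using integral_increment[OF h xy(1-3)] by (simp add: E_def algebra_simps)
      moreover have "norm (integral {x..y} ?k) \<le> integral {x..y} (\<lambda>t. e * ?n t)"
      proof (rule integral_norm_bound_integral)
        show "(\<lambda>t. e * ?n t) integrable_on {x..y}"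
          using absolutely_integrable_on_Icc_subset[OF n xy(1,2)] integrable_on_of_abs by auto
        fix t assume t: "t \<in> {x..y}"
        have "norm (g x - g t) \<le> e" "norm (f y - f t) \<le> e"
          using d1(2)[of t y] d2(2)[of t x] t xy d by auto
        then have "norm (f' t) * norm (g x - g t) + norm (f y - f t) * norm (g' t) \<le> norm (f' t) * e + e * norm (g' t)"
          using \<open>e > 0\<close> by (intro add_mono mult_mono) auto
        then show "norm (?k t) \<le> e * ?n t"
          using norm_triangle_ineq[of "f' t * (g x - g t)" "(f y - f t) * g' t"]
          unfolding norm_mult distrib_left mult.commute[of e] by linarith
      qed (rule integrable_on_of_abs[OF k])
      ultimately show "norm (E y - E x) \<le> e * (integral {a..y} ?n - integral {a..x} ?n)"
        using integral_increment[OF n xy(1-3)] by simp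
    qed (use d in auto)
  qed
  then show ?thesis
    by (simp add: E_def algebra_simps)
qed

text \<open>The chain rule for the exponential of an indefinite integral \<open>M\<close>.  The weight \<open>exp (c M)\<close> turns the Volterra
  operator with kernel bound \<open>m\<close> into one of norm at most \<open>1/c\<close> on the whole interval, which
  serves for both uniqueness and existence below.\<close>

lemma integral_exp_weight:
  fixes m :: "real \<Rightarrow> real" and c :: real
  assumes m: "m absolutely_integrable_on {a..b}" and m0: "\<And>t. t \<in> {a..b} \<Longrightarrow> 0 \<le> m t"
    and c: "c > 0" and x: "x \<in> {a..b}"
  defines "M \<equiv> \<lambda>x. integral {a..x} m"
  shows "integral {a..x} (\<lambda>t. m t * exp (c * M t)) = (exp (c * M x) - 1) / c"
proof -
  define w where "w t = exp (c * M t)" for t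
  have cM: "continuous_on {a..b} M"
    unfolding M_def by (rule continuous_on_indefinite_integral[OF m])
  have cw: "continuous_on {a..b} w"
    unfolding w_def by (intro continuous_intros cM)
  let ?h = "\<lambda>t. m t * w t"
  have h: "?h absolutely_integrable_on {a..b}"
    by (rule absolutely_integrable_mult_continuous[OF cw m])
  have M_inc: "M y - M x = integral {x..y} m" if "x \<in> {a..b}" "y \<in> {a..b}" "x \<le> y" for x y
    unfolding M_def using that by (intro integral_increment[OF m])
  have M_mono: "M x \<le> M y" if "x \<in> {a..b}" "y \<in> {a..b}" "x \<le> y" for x y
  proof -
    have "integral {x..y} m \<ge> 0"
      using that m0 absolutely_integrable_on_Icc_subset[OF m that(1,2)]
      by (intro Henstock_Kurzweil_Integration.integral_nonneg integrable_on_of_abs) auto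
    then show ?thesis using M_inc[OF that] by simp
  qed
  define E where "E x = w x - c * integral {a..x} ?h" for x
  have "E x = E a"
  proof (rule constant_of_small_increments[where V = M, OF _ x])
    fix e :: real assume "e > 0"
    obtain d where d: "d > 0"
        "\<And>x y. x \<in> {a..b} \<Longrightarrow> y \<in> {a..b} \<Longrightarrow> \<bar>y - x\<bar> \<le> d \<Longrightarrow> norm (w y - w x) \<le> e / c"
      using uniform_modulus_on_Icc[OF cw, of "e / c"] \<open>e > 0\<close> c by auto
    show "\<exists>d>0. \<forall>x\<in>{a..b}. \<forall>y\<in>{a..b}. x \<le> y \<longrightarrow> y \<le> x + d \<longrightarrow>
            norm (E y - E x) \<le> e * (M y - M x)"
    proof (rule exI[of _ d], intro conjI ballI impI)
      fix x y assume xy: "x \<in> {a..b}" "y \<in> {a..b}" "x \<le> y" "y \<le> x + d"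
      have mi: "m integrable_on {x..y}" and hi: "?h integrable_on {x..y}"
        using absolutely_integrable_on_Icc_subset[OF m xy(1,2)] absolutely_integrable_on_Icc_subset[OF h xy(1,2)]
        by (auto intro: integrable_on_of_abs)
      have w_mono: "w x \<le> w t" "w t \<le> w y" if "t \<in> {x..y}" for t
        using M_mono[of x t] M_mono[of t y] that xy c by (auto simp: w_def)
      have lo: "w x * (M y - M x) \<le> integral {x..y} ?h"
      proof -
        have "integral {x..y} (\<lambda>t. m t * w x) \<le> integral {x..y} ?h"
          using w_mono m0 xy mi hi by (intro integral_le mult_left_mono integrable_on_mult_left) auto
        then show ?thesis
          by (simp add: M_inc[OF xy(1-3)] mult.commute)
      qed
      have hi: "integral {x..y} ?h \<le> w y * (M y - M x)"
      proof -
        have "integral {x..y} ?h \<le> integral {x..y} (\<lambda>t. m t * w y)"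
          using w_mono m0 xy mi hi by (intro integral_le mult_left_mono integrable_on_mult_left) auto
        then show ?thesis
          by (simp add: M_inc[OF xy(1-3)] mult.commute)
      qed
      have tangent: "exp v - exp u \<ge> exp u * (v - u)" for u v :: real
        using exp_ge_add_one_self[of "v - u"] mult_left_mono[of "1 + (v - u)" "exp (v - u)" "exp u"]
        by (simp add: algebra_simps flip: exp_add)
      have lo': "w x * (c * (M y - M x)) \<le> w y - w x"
        using tangent[of "c * M x" "c * M y"] by (simp add: w_def algebra_simps)
      have hi': "w y - w x \<le> w y * (c * (M y - M x))"
        using tangent[of "c * M y" "c * M x"] by (simp add: w_def algebra_simps)
      have "w y - w x \<le> e / c"
        using d(2)[OF xy(1,2)] xy d(1) by (auto simp: abs_le_iff)
      then have "c * (w y - w x) \<le> e"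
        using c by (simp add: field_simps)
      then have "c * (w y - w x) * (M y - M x) \<le> e * (M y - M x)"
        using M_mono[OF xy(1-3)] by (intro mult_right_mono) auto
      moreover have "E y - E x = (w y - w x) - c * integral {x..y} ?h"
        using integral_increment[OF h xy(1-3)] by (simp add: E_def algebra_simps)
      moreover have "\<bar>(w y - w x) - c * integral {x..y} ?h\<bar> \<le> c * (w y - w x) * (M y - M x)"
      proof -
        have "c * (w x * (M y - M x)) \<le> c * integral {x..y} ?h"
             "c * integral {x..y} ?h \<le> c * (w y * (M y - M x))"
          using lo hi c by (auto intro: mult_left_mono)
        moreover have "c * (w y - w x) * (M y - M x) = w y * (c * (M y - M x)) - w x * (c * (M y - M x))"
          by (simp only: algebra_simps)
        ultimately show ?thesis
          using lo' hi' unfolding abs_le_iff mult.left_commute[of c] by linarith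
      qed
      ultimately show "norm (E y - E x) \<le> e * (M y - M x)"
        by simp
    qed (use d in auto)
  qed
  then have "c * integral {a..x} ?h = w x - 1"
    by (simp add: E_def w_def M_def)
  then show ?thesis
    using c by (simp only: w_def nonzero_eq_divide_eq[of c] mult.commute[of c])
qed

text \<open>Almost every point is a Lebesgue point from the right, and the averages over short intervals
  vanish.\<close>

lemma indefinite_integral_zero_imp_ae_zero:
  fixes f :: "real \<Rightarrow> 'a::euclidean_space"
  assumes f: "f absolutely_integrable_on {a..b}"
    and zero: "\<And>x. x \<in> {a..b} \<Longrightarrow> integral {a..x} f = 0"
  obtains N where "negligible N" "\<And>x. x \<in> {a..b} - N \<Longrightarrow> f x = 0"
proof -
  define g where "g x = (if x \<in> {a..b} then f x else 0)" for x
  have "g integrable_on UNIV"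
    unfolding g_def using integrable_restrict_UNIV integrable_on_of_abs[OF f] by blast
  then have "g integrable_on cbox c d" for c d
    by (rule integrable_on_subcbox) simp
  then obtain N where N: "negligible N" and lim: "\<And>x e. x \<notin> N \<Longrightarrow> 0 < e \<Longrightarrow>
      \<exists>d>0. \<forall>h. 0 < h \<and> h < d \<longrightarrow> norm (integral (cbox x (x + h *\<^sub>R One)) g /\<^sub>R h ^ DIM(real) - g x) < e"
    using integrable_ccontinuous_explicit[of g] by blast
  \<comment> \<open>At \<open>b\<close> the interval to the right leaves \<open>{a..b}\<close>, so this point joins the null set.\<close>
  have "f x = 0" if x: "x \<in> {a..b} - (N \<union> {b})" for x
  proof (rule ccontr)
    assume "f x \<noteq> 0"
    then obtain d where d: "d > 0" "\<And>h. 0 < h \<Longrightarrow> h < d \<Longrightarrow>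
        norm (integral (cbox x (x + h *\<^sub>R One)) g /\<^sub>R h ^ DIM(real) - g x) < norm (f x)"
      using lim[of x "norm (f x)"] x by auto
    define h where "h = min (d / 2) (b - x)"
    have h: "0 < h" "h < d" "x + h \<le> b"
      using d(1) x by (auto simp: h_def min_def)
    have "integral {x..x+h} g = integral {x..x+h} f"
      using x h by (intro Henstock_Kurzweil_Integration.integral_cong) (auto simp: g_def)
    also have "\<dots> = 0"
      using integral_increment[OF f, of x "x + h"] zero[of x] zero[of "x+h"] x h by auto
    finally show False
      using d(2)[OF h(1,2)] x by (simp add: g_def)
  qed
  then show thesis
    using that[of "N \<union> {b}"] N by auto
qed

lemma continuous_eq_0_of_indefinite_integral_zero:
  fixes f :: "real \<Rightarrow> 'a::euclidean_space"
  assumes f: "continuous_on {a..b} f" and "a < b"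
    and zero: "\<And>x. x \<in> {a..b} \<Longrightarrow> integral {a..x} f = 0" and x: "x \<in> {a..b}"
  shows "f x = 0"
proof -
  have "((\<lambda>x. integral {a..x} f) has_vector_derivative f x) (at x within {a..b})"
    by (rule integral_has_vector_derivative[OF f x])
  moreover have "((\<lambda>x. integral {a..x} f) has_vector_derivative 0) (at x within {a..b})"
    by (rule has_vector_derivative_transform[OF x _ has_vector_derivative_const]) (simp add: zero)
  ultimately show ?thesis
    using vector_derivative_unique_within_closed_interval[of a b x] x \<open>a < b\<close> by auto
qed

lemma LINT_Ioo_eq_integral:
  fixes f :: "real \<Rightarrow> 'a::euclidean_space"
  assumes "f absolutely_integrable_on {a..b}"
  shows "(LINT x|lebesgue_on {a<..<b}. f x) = integral {a..b} f"
proof -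
  have "integrable (lebesgue_on {a<..<b}) f"
    using assms unfolding absolutely_integrable_on_Icc_iff_Ioo
    by (rule absolutely_integrable_imp_integrable) auto
  then show ?thesis
    by (simp add: lebesgue_integral_eq_integral integral_open_interval_real)
qed

lemma AE_Ioo_imp_negligible:
  assumes "AE x in lebesgue_on {a<..<b}. P x"
  obtains N :: "real set" where "negligible N" "\<And>x. x \<in> {a..b} - N \<Longrightarrow> P x"
proof -
  have "AE x in lebesgue. x \<in> {a<..<b} \<longrightarrow> P x"
    using assms by (subst (asm) AE_restrict_space_iff) auto
  then obtain N where N: "negligible N" "{x. \<not> (x \<in> {a<..<b} \<longrightarrow> P x)} \<subseteq> N"
    unfolding eventually_ae_filter_negligible by blast
  show thesis
    using N by (intro that[of "N \<union> {a, b}"]) force+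
qed

lemma negligible_imp_AE_Ioo:
  assumes "negligible N" "\<And>x. x \<in> {a..b} - N \<Longrightarrow> P x"
  shows "AE x in lebesgue_on {a<..<b :: real}. P x"
proof -
  have "AE x in lebesgue. x \<in> {a<..<b} \<longrightarrow> P x"
    unfolding eventually_ae_filter_negligible using assms by (intro exI[of _ N]) force
  then show ?thesis
    by (subst AE_restrict_space_iff) auto
qed

section \<open>Linear Volterra equations with an integrable kernel\<close>

text \<open>With \<open>E = exp (2 M)\<close> and \<open>S\<close> the maximum of \<open>u / E\<close>, the integral of \<open>m u\<close> is at most \<open>S (E - 1) / 2\<close>;
  evaluating the hypothesis where the maximum is attained gives \<open>S \<le> 2 c\<close>.\<close>

lemma gronwall:
  fixes u m :: "real \<Rightarrow> real"
  assumes m: "m absolutely_integrable_on {a..b}" and m0: "\<And>t. t \<in> {a..b} \<Longrightarrow> 0 \<le> m t"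
    and u: "continuous_on {a..b} u" and c: "0 \<le> c"
    and le: "\<And>x. x \<in> {a..b} \<Longrightarrow> u x \<le> c + integral {a..x} (\<lambda>t. m t * u t)"
    and x: "x \<in> {a..b}"
  shows "u x \<le> 2 * c * exp (2 * integral {a..x} m)"
proof -
  define E where "E t = exp (2 * integral {a..t} m)" for t
  have E0: "E t > 0" for t by (simp add: E_def)
  have cE: "continuous_on {a..b} E"
    unfolding E_def by (intro continuous_intros continuous_on_indefinite_integral[OF m])
  have "continuous_on {a..b} (\<lambda>t. u t / E t)"
    using E0 by (intro continuous_intros u cE) (simp add: less_imp_neq[symmetric])
  then obtain z where z: "z \<in> {a..b}" "\<And>t. t \<in> {a..b} \<Longrightarrow> u t / E t \<le> u z / E z"
    using continuous_attains_sup[of "{a..b}" "\<lambda>t. u t / E t"] x by auto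
  define S where "S = u z / E z"
  have uS: "u t \<le> S * E t" if "t \<in> {a..b}" for t
    using z(2)[OF that] E0[of t] by (simp add: S_def field_simps)
  have sub: "f integrable_on {a..z}" if "f absolutely_integrable_on {a..b}" for f :: "real \<Rightarrow> real"
    using absolutely_integrable_on_Icc_subset[OF that, of a z] z(1) by (auto intro: integrable_on_of_abs)
  have "S * E z = u z"
    using E0[of z] by (simp add: S_def)
  also have "\<dots> \<le> c + integral {a..z} (\<lambda>t. m t * u t)"
    by (rule le[OF z(1)])
  also have "integral {a..z} (\<lambda>t. m t * u t) \<le> integral {a..z} (\<lambda>t. S * (m t * E t))"
  proof (intro integral_le sub)
    fix t assume "t \<in> {a..z}"
    then show "m t * u t \<le> S * (m t * E t)"
      using mult_left_mono[OF uS[of t] m0[of t]] z(1) by (simp add: mult.left_commute)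
  qed (intro set_integrable_mult_right absolutely_integrable_mult_continuous u cE m impI)+
  also have "\<dots> = S * ((E z - 1) / 2)"
    using integral_exp_weight[OF m m0, of 2 z] z(1) by (simp add: E_def)
  finally have "S * (E z + 1) \<le> 2 * c"
    by (simp add: field_simps)
  then have "S \<le> 2 * c"
  proof (cases "S \<ge> 0")
    case True
    then have "S * 1 \<le> S * (E z + 1)"
      using E0[of z] by (intro mult_left_mono) auto
    then show ?thesis using \<open>S * (E z + 1) \<le> 2 * c\<close> by simp
  qed (use c in simp)
  then show ?thesis
    using order_trans[OF uS[OF x] mult_right_mono[of S "2 * c" "E x"]] E0[of x] by (simp add: E_def)
qed

text \<open>The equations \<open>y(x) = h(x) + \<integral>\<^sub>a\<^sup>x K t (y t) dt\<close> with an additive kernel dominated by an integrable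
  function of \<open>t\<close>.  Measurability of the kernel enters through \<open>K_int\<close>, which makes the right-hand side
  meaningful for every continuous \<open>y\<close>.\<close>

locale volterra =
  fixes a b :: real and K :: "real \<Rightarrow> 'a::euclidean_space \<Rightarrow> 'a" and m :: "real \<Rightarrow> real"
  assumes m: "m absolutely_integrable_on {a..b}"
    and m0: "\<And>t. t \<in> {a..b} \<Longrightarrow> 0 \<le> m t"
    and K_int: "\<And>y. continuous_on {a..b} y \<Longrightarrow> (\<lambda>t. K t (y t)) absolutely_integrable_on {a..b}"
    and K_diff: "\<And>t u v. K t (u - v) = K t u - K t v"
    and K_bound: "\<And>t v. t \<in> {a..b} \<Longrightarrow> norm (K t v) \<le> m t * norm v"

context volterra
begin

lemma K_integral_bound:
  assumes y: "continuous_on {a..b} y" and g: "continuous_on {a..b} g"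
    and le: "\<And>t. t \<in> {a..b} \<Longrightarrow> norm (y t) \<le> g t" and x: "x \<in> {a..b}"
  shows "norm (integral {a..x} (\<lambda>t. K t (y t))) \<le> integral {a..x} (\<lambda>t. m t * g t)"
proof (rule integral_norm_bound_integral)
  show "(\<lambda>t. K t (y t)) integrable_on {a..x}"
    using absolutely_integrable_on_Icc_subset[OF K_int[OF y], of a x] x integrable_on_of_abs by auto
  show "(\<lambda>t. m t * g t) integrable_on {a..x}"
    using absolutely_integrable_on_Icc_subset[OF absolutely_integrable_mult_continuous[OF g m], of a x] x
      integrable_on_of_abs by auto
  fix t assume "t \<in> {a..x}"
  then have "norm (K t (y t)) \<le> m t * norm (y t)" "m t * norm (y t) \<le> m t * g t"
    using x K_bound le m0 by (auto intro!: mult_left_mono)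
  then show "norm (K t (y t)) \<le> m t * g t" by simp
qed

lemma K_integral_diff:
  assumes "continuous_on {a..b} y" "continuous_on {a..b} z" "x \<in> {a..b}"
  shows "integral {a..x} (\<lambda>t. K t (y t)) - integral {a..x} (\<lambda>t. K t (z t))
           = integral {a..x} (\<lambda>t. K t (y t - z t))"
  unfolding K_diff
  using absolutely_integrable_on_Icc_subset[OF K_int[OF assms(1)], of a x]
    absolutely_integrable_on_Icc_subset[OF K_int[OF assms(2)], of a x] assms(3)
  by (intro Henstock_Kurzweil_Integration.integral_diff[symmetric]) (auto intro: integrable_on_of_abs)

lemma solution_bound:
  assumes y: "continuous_on {a..b} y"
    and eq: "\<And>x. x \<in> {a..b} \<Longrightarrow> y x = h x + integral {a..x} (\<lambda>t. K t (y t))"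
    and h: "\<And>x. x \<in> {a..b} \<Longrightarrow> norm (h x) \<le> c" and x: "x \<in> {a..b}"
  shows "norm (y x) \<le> 2 * c * exp (2 * integral {a..b} m)"
proof -
  have c: "c \<ge> 0"
    using order_trans[OF norm_ge_zero h[OF x]] .
  have "norm (y x) \<le> 2 * c * exp (2 * integral {a..x} m)"
  proof (rule gronwall[OF m m0 _ c _ x])
    show "continuous_on {a..b} (\<lambda>t. norm (y t))"
      by (intro continuous_intros y)
    then show "norm (y x) \<le> c + integral {a..x} (\<lambda>t. m t * norm (y t))" if "x \<in> {a..b}" for x
      using norm_triangle_ineq[of "h x" "integral {a..x} (\<lambda>t. K t (y t))"] h[OF that]
        K_integral_bound[OF y, of "\<lambda>t. norm (y t)" x] that by (subst eq[OF that]) auto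
  qed auto
  also have "\<dots> \<le> 2 * c * exp (2 * integral {a..b} m)"
  proof -
    have "integral {a..b} m - integral {a..x} m = integral {x..b} m"
      using x by (intro integral_increment[OF m]) auto
    moreover have "integral {x..b} m \<ge> 0"
      using x m0 absolutely_integrable_on_Icc_subset[OF m, of x b]
      by (intro Henstock_Kurzweil_Integration.integral_nonneg integrable_on_of_abs) auto
    ultimately show ?thesis
      using c by (intro mult_left_mono) auto
  qed
  finally show ?thesis .
qed

text \<open>Picard iteration.  Measured against the weight \<open>exp (2 M)\<close>, successive differences shrink by the factor
  \<open>1/2\<close>, so the iterates converge uniformly.\<close>

lemma solution_exists:
  assumes h: "continuous_on {a..b} h"
  obtains y where "continuous_on {a..b} y"
    "\<And>x. x \<in> {a..b} \<Longrightarrow> y x = h x + integral {a..x} (\<lambda>t. K t (y t))"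
proof -
  define Y where "Y = rec_nat h (\<lambda>_ y x. h x + integral {a..x} (\<lambda>t. K t (y t)))"
  have Y0: "Y 0 = h" and YS: "Y (Suc n) = (\<lambda>x. h x + integral {a..x} (\<lambda>t. K t (Y n t)))" for n
    by (simp_all add: Y_def)
  have cY: "continuous_on {a..b} (Y n)" for n
  proof (induction n)
    case (Suc n)
    then show ?case
      unfolding YS by (intro continuous_intros h continuous_on_indefinite_integral K_int)
  qed (simp add: Y0 h)
  define E where "E t = exp (2 * integral {a..t} m)" for t
  have cE: "continuous_on {a..b} E"
    unfolding E_def by (intro continuous_intros continuous_on_indefinite_integral[OF m])
  have E1: "E t \<ge> 1" if "t \<in> {a..b}" for t
  proof -
    have "integral {a..t} m \<ge> 0"
      using that m0 absolutely_integrable_on_Icc_subset[OF m, of a t]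
      by (intro Henstock_Kurzweil_Integration.integral_nonneg integrable_on_of_abs) auto
    then show ?thesis by (simp add: E_def)
  qed
  have "bounded ((\<lambda>x. Y 1 x - Y 0 x) ` {a..b})"
    by (intro compact_imp_bounded compact_continuous_image continuous_intros cY) auto
  then obtain D where D: "D > 0" "\<And>x. x \<in> {a..b} \<Longrightarrow> norm (Y 1 x - Y 0 x) \<le> D"
    unfolding bounded_pos by auto
  have contraction: "\<forall>x\<in>{a..b}. norm (Y (Suc n) x - Y n x) \<le> D * (1/2)^n * E x" for n
  proof (induction n)
    case 0
    show ?case
    proof
      fix x assume x: "x \<in> {a..b}"
      have "D * 1 \<le> D * E x"
        using E1[OF x] D(1) by (intro mult_left_mono) auto
      then show "norm (Y (Suc 0) x - Y 0 x) \<le> D * (1/2)^0 * E x"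
        using D(2)[OF x] by simp
    qed
  next
    case (Suc n)
    show ?case
    proof
      fix x assume x: "x \<in> {a..b}"
      have "norm (Y (Suc (Suc n)) x - Y (Suc n) x) = norm (integral {a..x} (\<lambda>t. K t (Y (Suc n) t - Y n t)))"
        unfolding K_integral_diff[OF cY cY x, symmetric] YS[of "Suc n"] by (simp add: YS[of n])
      also have "\<dots> \<le> integral {a..x} (\<lambda>t. m t * (D * (1/2)^n * E t))"
        using Suc by (intro K_integral_bound continuous_intros cY cE x) auto
      also have "\<dots> = D * (1/2)^n * integral {a..x} (\<lambda>t. m t * E t)"
        unfolding integral_mult_right[symmetric] by (simp only: ac_simps)
      also have "integral {a..x} (\<lambda>t. m t * E t) = (E x - 1) / 2"
        using integral_exp_weight[OF m m0, of 2 x] x by (simp add: E_def)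
      also have "D * (1/2)^n * ((E x - 1) / 2) \<le> D * (1/2)^n * (E x / 2)"
        using D(1) by (intro mult_left_mono) auto
      finally show "norm (Y (Suc (Suc n)) x - Y (Suc n) x) \<le> D * (1/2)^(Suc n) * E x"
        by simp
    qed
  qed
  have "bounded (E ` {a..b})"
    by (intro compact_imp_bounded compact_continuous_image cE) auto
  then obtain C where C: "C > 0" "\<And>x. x \<in> {a..b} \<Longrightarrow> norm (E x) \<le> C"
    unfolding bounded_pos by auto
  have "uniform_limit {a..b} (\<lambda>n x. \<Sum>i<n. Y (Suc i) x - Y i x) (\<lambda>x. \<Sum>i. Y (Suc i) x - Y i x) sequentially"
  proof (rule Weierstrass_m_test)
    show "norm (Y (Suc n) x - Y n x) \<le> D * C * (1/2)^n" if x: "x \<in> {a..b}" for n x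
    proof -
      have "D * (1/2)^n * E x \<le> D * (1/2)^n * C"
        using C(2)[OF x] D(1) by (intro mult_left_mono) auto
      then show ?thesis
        using bspec[OF contraction x, of n] by (simp add: ac_simps)
    qed
    show "summable (\<lambda>n. D * C * (1/2)^n)"
      by (intro summable_mult summable_geometric) auto
  qed
  then have lim: "uniform_limit {a..b} (\<lambda>n x. Y n x - h x) (\<lambda>x. \<Sum>i. Y (Suc i) x - Y i x) sequentially"
    by (simp add: sum_lessThan_telescope[of "\<lambda>i. Y i _"] Y0)
  define y where "y x = (\<Sum>i. Y (Suc i) x - Y i x) + h x" for x
  have lim: "uniform_limit {a..b} Y y sequentially"
  proof -
    have "uniform_limit {a..b} (\<lambda>n x. (Y n x - h x) + h x)
            (\<lambda>x. (\<Sum>i. Y (Suc i) x - Y i x) + h x) sequentially"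
      by (intro uniform_limit_add lim uniform_limit_const)
    then show ?thesis by (simp add: y_def[abs_def])
  qed
  have cy: "continuous_on {a..b} y"
    using lim by (rule uniform_limit_theorem[rotated]) (auto simp: cY)
  have "y x = h x + integral {a..x} (\<lambda>t. K t (y t))" if x: "x \<in> {a..b}" for x
  proof -
    let ?M = "integral {a..x} m"
    have "?M \<ge> 0"
      using x m0 absolutely_integrable_on_Icc_subset[OF m, of a x]
      by (intro Henstock_Kurzweil_Integration.integral_nonneg integrable_on_of_abs) auto
    have "norm (y x - (h x + integral {a..x} (\<lambda>t. K t (y t)))) \<le> 0 + e" if "e > 0" for e
    proof -
      define d where "d = e / (1 + ?M)"
      have "d > 0" using \<open>e > 0\<close> \<open>?M \<ge> 0\<close> by (simp add: d_def)
      then obtain N where N: "\<And>n t. n \<ge> N \<Longrightarrow> t \<in> {a..b} \<Longrightarrow> dist (Y n t) (y t) < d"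
        using uniform_limitD[OF lim] unfolding eventually_sequentially by blast
      have "norm (Y (Suc N) x - (h x + integral {a..x} (\<lambda>t. K t (y t))))
              = norm (integral {a..x} (\<lambda>t. K t (Y N t - y t)))"
        unfolding K_integral_diff[OF cY cy x, symmetric] by (simp add: YS)
      also have "\<dots> \<le> integral {a..x} (\<lambda>t. m t * d)"
        using N[of N] by (intro K_integral_bound continuous_intros cY cy x) (auto simp: dist_norm less_imp_le)
      also have "\<dots> = ?M * d"
        by simp
      finally have "norm (y x - (h x + integral {a..x} (\<lambda>t. K t (y t)))) \<le> d + ?M * d"
        using N[of "Suc N" x] x
        by (intro norm_diff_triangle_le[of _ "Y (Suc N) x"]) (auto simp: dist_norm norm_minus_commute)
      also have "\<dots> = (1 + ?M) * d" by (simp add: algebra_simps)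
      also have "\<dots> = e" using \<open>?M \<ge> 0\<close> by (simp add: d_def)
      finally show ?thesis by simp
    qed
    then have "norm (y x - (h x + integral {a..x} (\<lambda>t. K t (y t)))) \<le> 0"
      by (rule field_le_epsilon)
    then show ?thesis by simp
  qed
  then show thesis using that cy by blast
qed

end

section \<open>Entire functions bounded by the reciprocal of the imaginary part\<close>

text \<open>On the circle of radius \<open>R\<close> one has \<open>w\<^sup>2 - R\<^sup>2 = w (w - cnj w)\<close>, of modulus \<open>2 R \<bar>Im w\<bar>\<close>.  This factor
  cancels the blow-up of the bound at the real axis, and the maximum principle gives
  \<open>\<bar>f z\<bar> R\<^sup>2 / 2 \<le> 2 R K\<close> for every large \<open>R\<close>.\<close>

lemma entire_eq_0_of_imaginary_bound:
  assumes hol: "f holomorphic_on UNIV"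
    and bound: "\<And>z. Im z \<noteq> 0 \<Longrightarrow> cmod (f z) \<le> K / \<bar>Im z\<bar>"
  shows "f z = 0"
proof -
  have K: "0 \<le> K"
    using order_trans[OF norm_ge_zero bound[of \<i>]] by simp
  have large: "cmod (f z) * R \<le> 4 * K" if R: "2 * cmod z < R" "0 < R" for R
  proof -
    define g where "g w = f w * (w\<^sup>2 - of_real (R\<^sup>2))" for w
    have holg: "g holomorphic_on UNIV"
      unfolding g_def by (intro holomorphic_intros hol)
    have "cmod (g z) \<le> 2 * R * K"
    proof (rule maximum_modulus_frontier[where S = "ball 0 R" and f = g and \<xi> = z])
      show "g holomorphic_on interior (ball 0 R)"
        by (rule holomorphic_on_subset[OF holg]) simp
      show "continuous_on (closure (ball 0 R)) g"
        by (rule continuous_on_subset[OF holomorphic_on_imp_continuous_on[OF holg]]) simp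
      show "z \<in> ball 0 R" using R by simp
      fix w assume "w \<in> frontier (ball (0::complex) R)"
      then have w: "cmod w = R" using R by (simp add: frontier_ball)
      then have "w\<^sup>2 - of_real (R\<^sup>2) = w * (w - cnj w)"
        using complex_norm_square[of w] by (simp add: power2_eq_square algebra_simps)
      also have "w - cnj w = 2 * \<i> * of_real (Im w)"
        by (simp add: complex_eq_iff)
      finally have fac: "cmod (w\<^sup>2 - of_real (R\<^sup>2)) = 2 * R * \<bar>Im w\<bar>"
        by (simp add: norm_mult w)
      show "cmod (g w) \<le> 2 * R * K"
      proof (cases "Im w = 0")
        case True
        then show ?thesis using fac K R by (simp add: g_def norm_mult)
      next
        case False
        then have "cmod (f w) * \<bar>Im w\<bar> \<le> K"
          using bound[OF False] by (simp add: field_simps)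
        then have "2 * R * (cmod (f w) * \<bar>Im w\<bar>) \<le> 2 * R * K"
          using R by (intro mult_left_mono) auto
        then show ?thesis unfolding g_def norm_mult fac by (simp only: mult_ac)
      qed
    qed simp
    moreover have "R\<^sup>2 / 2 \<le> cmod (z\<^sup>2 - of_real (R\<^sup>2))"
    proof -
      have "(cmod z)\<^sup>2 \<le> (R / 2)\<^sup>2"
        using R by (intro power_mono) auto
      moreover have "(R / 2)\<^sup>2 = R\<^sup>2 / 4"
        by (simp add: power_divide)
      ultimately have "R\<^sup>2 / 2 \<le> R\<^sup>2 - (cmod z)\<^sup>2"
        using zero_le_power2[of R] by linarith
      also have "\<dots> \<le> cmod (of_real (R\<^sup>2) - z\<^sup>2)"
        using norm_triangle_ineq2[of "of_real (R\<^sup>2)" "z\<^sup>2"] by (simp add: norm_power norm_mult power2_eq_square)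
      finally show ?thesis by (simp add: norm_minus_commute)
    qed
    ultimately have "cmod (f z) * (R\<^sup>2 / 2) \<le> 2 * R * K"
      unfolding g_def norm_mult by (meson mult_left_mono norm_ge_zero order_trans)
    then have "R * (cmod (f z) * R) \<le> R * (4 * K)"
      by (simp add: power2_eq_square algebra_simps)
    then show ?thesis using R by simp
  qed
  show ?thesis
  proof (rule ccontr)
    assume "f z \<noteq> 0"
    define R where "R = 2 * cmod z + 1 + 4 * K / cmod (f z)"
    have "cmod (f z) * R = cmod (f z) * (2 * cmod z + 1) + 4 * K"
      using \<open>f z \<noteq> 0\<close> by (simp add: R_def distrib_left)
    moreover have "cmod (f z) * (2 * cmod z + 1) > 0"
      using \<open>f z \<noteq> 0\<close> by (intro mult_pos_pos add_nonneg_pos) auto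
    moreover have "2 * cmod z < R"
      using K by (simp add: R_def add_pos_nonneg)
    ultimately show False
      using large[of R] norm_ge_zero[of z] by linarith
  qed
qed

section \<open>Functions with values in the complex plane squared\<close>

lemma complex2_eq_iff: "u = v \<longleftrightarrow> u $ 1 = v $ 1 \<and> u $ 2 = v $ 2" for u v :: "complex^2"
  by (simp add: vec_eq_iff forall_2)

lemma norm_vector_scalar_mult [simp]: "norm (c *s v) = cmod c * norm v" for v :: "complex^'n"
  by (simp add: norm_vec_def L2_set_def norm_mult power_mult_distrib real_sqrt_mult
      flip: sum_distrib_left)

lemma norm_complex2_le: "norm v \<le> cmod (v $ 1) + cmod (v $ 2)" for v :: "complex^2"
  using L2_set_le_sum[of "UNIV :: 2 set" "\<lambda>i. cmod (v $ i)"] by (simp add: norm_vec_def UNIV_2)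

lemma continuous_on_vector_scalar_mult:
  fixes f :: "'a::topological_space \<Rightarrow> complex^2"
  assumes "continuous_on S f"
  shows "continuous_on S (\<lambda>t. c *s f t)"
  unfolding vector_scalar_mult_def by (intro continuous_on_vec_lambda continuous_intros assms)

lemma absolutely_integrable_vec_nth:
  fixes f :: "real \<Rightarrow> complex^2"
  assumes "f absolutely_integrable_on S"
  shows "(\<lambda>t. f t $ i) absolutely_integrable_on S"
  using absolutely_integrable_linear[OF assms bounded_linear_vec_nth] by (simp add: o_def)

lemma absolutely_integrable_vector2:
  fixes f g :: "real \<Rightarrow> complex"
  assumes "f absolutely_integrable_on S" "g absolutely_integrable_on S"
  shows "(\<lambda>t. vector [f t, g t] :: complex^2) absolutely_integrable_on S"
proof -
  have "linear (\<lambda>z. vector [z, 0] :: complex^2)" "linear (\<lambda>z. vector [0, z] :: complex^2)"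
    by (auto intro!: linearI simp: complex2_eq_iff)
  then have "(\<lambda>t. vector [f t, 0] + vector [0, g t] :: complex^2) absolutely_integrable_on S"
    using absolutely_integrable_linear[OF assms(1)] absolutely_integrable_linear[OF assms(2)]
    by (intro set_integral_add) (auto simp: o_def linear_conv_bounded_linear)
  moreover have "vector [f t, 0] + vector [0, g t] = (vector [f t, g t] :: complex^2)" for t
    by (simp add: complex2_eq_iff)
  ultimately show ?thesis by simp
qed

lemma absolutely_integrable_vector_scalar_mult:
  fixes f :: "real \<Rightarrow> complex^2"
  assumes "f absolutely_integrable_on S"
  shows "(\<lambda>t. c *s f t) absolutely_integrable_on S"
proof -
  have "linear (\<lambda>v :: complex^2. c *s v)"
    by (auto intro!: linearI simp: complex2_eq_iff algebra_simps)
  then show ?thesis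
    using absolutely_integrable_linear[OF assms, of "\<lambda>v. c *s v"]
    by (simp add: o_def linear_conv_bounded_linear)
qed

lemma integral_vec_nth:
  fixes f :: "real \<Rightarrow> complex^2"
  assumes "f absolutely_integrable_on S"
  shows "integral S f $ i = integral S (\<lambda>t. f t $ i)"
  using integral_linear[OF integrable_on_of_abs[OF assms] bounded_linear_vec_nth, of i]
  by (simp add: o_def)

lemma integral_vector_scalar_mult:
  fixes f :: "real \<Rightarrow> complex^2"
  assumes "f absolutely_integrable_on S"
  shows "integral S (\<lambda>t. c *s f t) = c *s integral S f"
proof -
  have "linear (\<lambda>v :: complex^2. c *s v)"
    by (auto intro!: linearI simp: complex2_eq_iff algebra_simps)
  then show ?thesis
    using integral_linear[OF integrable_on_of_abs[OF assms], of "\<lambda>v. c *s v"]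
    by (simp add: o_def linear_conv_bounded_linear)
qed

text \<open>The Hermitian inner product of \<open>\<complex>\<^sup>2\<close>, linear in the first argument.\<close>

definition cdot :: "complex^2 \<Rightarrow> complex^2 \<Rightarrow> complex" where
  "cdot u v = u $ 1 * cnj (v $ 1) + u $ 2 * cnj (v $ 2)"

lemma cdot_self: "cdot v v = complex_of_real ((norm v)\<^sup>2)"
proof -
  have "(norm v)\<^sup>2 = (cmod (v $ 1))\<^sup>2 + (cmod (v $ 2))\<^sup>2"
    by (simp add: norm_vec_def L2_set_def UNIV_2)
  then show ?thesis
    by (simp only: cdot_def complex_norm_square of_real_add)
qed

lemma cnj_cdot: "cnj (cdot u v) = cdot v u"
  by (simp add: cdot_def mult.commute)

lemma cdot_add_scale_left: "cdot (u + c *s v) w = cdot u w + c * cdot v w"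
  by (simp add: cdot_def algebra_simps)

lemma mult_sum_of_squares_le:
  fixes x y e :: real
  assumes "0 < e"
  shows "x * y \<le> (x\<^sup>2 / e + e * y\<^sup>2) / 2"
proof -
  have "0 \<le> (x - e * y)\<^sup>2 / e" using assms by simp
  then show ?thesis using assms by (simp add: power2_eq_square field_simps)
qed

text \<open>Young's inequality with a free parameter, the Cauchy-Schwarz inequality in a form that can be
  integrated pointwise; the resolvent estimate takes \<open>e = \<bar>Im \<mu>\<bar>\<close>.\<close>

lemma cdot_sum_of_squares_le:
  assumes "0 < e"
  shows "cmod (cdot u v) \<le> ((norm u)\<^sup>2 / e + e * (norm v)\<^sup>2) / 2"
proof -
  have n: "(norm v)\<^sup>2 = (cmod (v $ 1))\<^sup>2 + (cmod (v $ 2))\<^sup>2" for v :: "complex^2"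
    by (simp add: norm_vec_def L2_set_def UNIV_2)
  have "cmod (cdot u v) \<le> cmod (u $ 1) * cmod (v $ 1) + cmod (u $ 2) * cmod (v $ 2)"
    unfolding cdot_def by (rule order_trans[OF norm_triangle_ineq]) (simp add: norm_mult)
  also have "\<dots> \<le> ((norm u)\<^sup>2 / e + e * (norm v)\<^sup>2) / 2"
    using mult_sum_of_squares_le[OF assms, of "cmod (u $ 1)" "cmod (v $ 1)"]
      mult_sum_of_squares_le[OF assms, of "cmod (u $ 2)" "cmod (v $ 2)"]
    unfolding n by (simp add: add_divide_distrib distrib_left)
  finally show ?thesis .
qed

section \<open>The Dirac system as a Volterra equation\<close>

lemma in_L2_absolutely_integrable:
  assumes "in_L2 f"
  shows "f absolutely_integrable_on {0..pi}"
  unfolding absolutely_integrable_on_Icc_iff_Ioo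
proof (rule measurable_bounded_by_integrable_imp_absolutely_integrable)
  show "f \<in> borel_measurable (lebesgue_on {0<..<pi})"
    using assms by (simp add: in_L2_def)
  have "integrable (lebesgue_on {0<..<pi}) (\<lambda>x. (f x)\<^sup>2)"
    using assms by (simp add: in_L2_def)
  then have "(\<lambda>x. (f x)\<^sup>2) integrable_on {0<..<pi}"
    by (rule integrable_on_lebesgue_on) auto
  moreover have "(\<lambda>x. 1 :: real) integrable_on {0<..<pi}"
    by (simp add: integrable_on_open_interval_real integrable_const_ivl)
  ultimately show "(\<lambda>x. 1 + (f x)\<^sup>2) integrable_on {0<..<pi}"
    by (intro Henstock_Kurzweil_Integration.integrable_add)
  show "norm (f x) \<le> 1 + (f x)\<^sup>2" for x
    using sum_squares_bound[of 1 "\<bar>f x\<bar>"] by (simp add: power2_eq_square)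
qed auto

locale dirac_system =
  fixes a \<alpha> :: real and p q :: "real \<Rightarrow> real"
  assumes \<alpha>: "0 < \<alpha>" and p_L2: "in_L2 p" and q_L2: "in_L2 q"

context dirac_system
begin

abbreviation \<rho> :: "real \<Rightarrow> complex" where "\<rho> t \<equiv> complex_of_real (rho a \<alpha> t)"

lemma rho_pos: "0 < rho a \<alpha> t"
  using \<alpha> by (simp add: rho_def)

lemma rho_le: "rho a \<alpha> t \<le> 1 + \<alpha>"
  using \<alpha> by (simp add: rho_def)

lemma rho_ge: "min 1 \<alpha> \<le> rho a \<alpha> t"
  by (simp add: rho_def)

lemma rho_measurable [measurable]: "rho a \<alpha> \<in> borel_measurable borel"
  unfolding rho_def[abs_def] by measurable

lemma rho_integrable: "rho a \<alpha> absolutely_integrable_on {0..pi}"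
proof (rule measurable_bounded_by_integrable_imp_absolutely_integrable[where g = "\<lambda>_. 1 + \<alpha>"])
  show "rho a \<alpha> \<in> borel_measurable (lebesgue_on {0..pi})"
    by (intro measurable_restrict_space1 measurable_completion) measurable
  show "norm (rho a \<alpha> t) \<le> 1 + \<alpha>" for t
    using rho_pos[of t] rho_le[of t] by simp
qed auto

lemma coefficient_integrable:
  "(\<lambda>t. complex_of_real (p t)) absolutely_integrable_on {0..pi}"
  "(\<lambda>t. complex_of_real (q t)) absolutely_integrable_on {0..pi}"
  "\<rho> absolutely_integrable_on {0..pi}"
  using absolutely_integrable_linear[OF in_L2_absolutely_integrable[OF p_L2] bounded_linear_of_real]
    absolutely_integrable_linear[OF in_L2_absolutely_integrable[OF q_L2] bounded_linear_of_real]
    absolutely_integrable_linear[OF rho_integrable bounded_linear_of_real]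
  by (auto simp: o_def)

lemma rho_mult_integrable:
  fixes f :: "real \<Rightarrow> complex"
  assumes "f absolutely_integrable_on {0..pi}"
  shows "(\<lambda>t. \<rho> t * f t) absolutely_integrable_on {0..pi}"
proof (rule absolutely_integrable_bounded_measurable_product[where h = "(*)", OF _ _ _ _ assms])
  have "\<rho> \<in> borel_measurable borel" by measurable
  then show "\<rho> \<in> borel_measurable (lebesgue_on {0..pi})"
    by (intro measurable_restrict_space1 measurable_completion) simp
  show "bounded (\<rho> ` {0..pi})"
    using rho_le rho_pos by (intro boundedI[of _ "1 + \<alpha>"]) (auto simp: abs_of_pos)
qed (use bilinear_conv_bounded_bilinear bounded_bilinear_mult in auto)

text \<open>The matrix \<open>- \<rho>(t) B\<close>: solving the system for \<open>y'\<close> multiplies both \<open>\<mu> \<rho> y\<close> and an inhomogeneity \<open>\<rho> z\<close> by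
  \<open>- B\<close>, the inverse of \<open>B\<close>.\<close>

definition rhoJ :: "real \<Rightarrow> complex^2 \<Rightarrow> complex^2" where
  "rhoJ t v = vector [- (\<rho> t * v $ 2), \<rho> t * v $ 1]"

text \<open>The right-hand side of the system solved for the derivative, \<open>y' = - B (\<mu> \<rho> y - \<Omega> y)\<close>.\<close>

definition dirac :: "complex \<Rightarrow> real \<Rightarrow> complex^2 \<Rightarrow> complex^2" where
  "dirac \<mu> t v = vector [q t * v $ 1 - p t * v $ 2, - (p t * v $ 1) - q t * v $ 2] + \<mu> *s rhoJ t v"

text \<open>A kernel bound that is common to all spectral parameters of modulus at most \<open>R\<close>; this uniformity is
  what makes the estimates of the parameter dependence locally uniform.\<close>

definition dirac_bound :: "real \<Rightarrow> real \<Rightarrow> real" where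
  "dirac_bound R t = 2 * (\<bar>p t\<bar> + \<bar>q t\<bar> + R * rho a \<alpha> t)"

lemma rhoJ_0 [simp]: "rhoJ t 0 = 0"
  by (simp add: rhoJ_def complex2_eq_iff)

lemma rhoJ_diff: "rhoJ t (u - v) = rhoJ t u - rhoJ t v"
  by (simp add: rhoJ_def complex2_eq_iff algebra_simps)

lemma dirac_scale: "dirac \<mu> t (c *s v) = c *s dirac \<mu> t v"
  by (simp add: dirac_def rhoJ_def complex2_eq_iff algebra_simps)

lemma dirac_parameter: "dirac \<mu> t v = dirac \<kappa> t v + (\<mu> - \<kappa>) *s rhoJ t v"
  by (simp add: dirac_def rhoJ_def complex2_eq_iff algebra_simps)

lemma dirac_equation_iff:
  "B_mat *v w + Omega p q t *v v = (\<mu> * \<rho> t) *s v + \<rho> t *s z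
     \<longleftrightarrow> w = dirac \<mu> t v + rhoJ t z"
  by (auto simp: B_mat_def Omega_def dirac_def rhoJ_def complex2_eq_iff matrix_vector_mult_def sum_2
      algebra_simps)

lemma rhoJ_integrable_L1:
  assumes "z absolutely_integrable_on {0..pi}"
  shows "(\<lambda>t. rhoJ t (z t)) absolutely_integrable_on {0..pi}"
  unfolding rhoJ_def
  by (intro absolutely_integrable_vector2 absolutely_integrable_minus rho_mult_integrable
      absolutely_integrable_vec_nth assms)

lemma rhoJ_integrable:
  assumes "continuous_on {0..pi} y"
  shows "(\<lambda>t. rhoJ t (y t)) absolutely_integrable_on {0..pi}"
  by (rule rhoJ_integrable_L1[OF absolutely_integrable_continuous_real[OF assms]])

lemma norm_rhoJ_le: "norm (rhoJ t v) \<le> 2 * rho a \<alpha> t * norm v"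
proof -
  have "norm (rhoJ t v) \<le> rho a \<alpha> t * cmod (v $ 2) + rho a \<alpha> t * cmod (v $ 1)"
    using norm_complex2_le[of "rhoJ t v"] rho_pos[of t] by (simp add: rhoJ_def norm_mult)
  also have "\<dots> \<le> rho a \<alpha> t * norm v + rho a \<alpha> t * norm v"
    using rho_pos[of t] by (intro add_mono mult_left_mono Finite_Cartesian_Product.norm_nth_le) auto
  finally show ?thesis by (simp add: mult.commute)
qed

lemma integral_rhoJ_bound:
  assumes y: "continuous_on {0..pi} y" and le: "\<And>t. t \<in> {0..pi} \<Longrightarrow> norm (y t) \<le> c" and x: "x \<in> {0..pi}"
  shows "norm (integral {0..x} (\<lambda>t. rhoJ t (y t))) \<le> 2 * (1 + \<alpha>) * c * pi"
proof -
  have c: "0 \<le> c" using order_trans[OF norm_ge_zero le[OF x]] .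
  have "norm (integral {0..x} (\<lambda>t. rhoJ t (y t))) \<le> integral {0..x} (\<lambda>t. 2 * (1 + \<alpha>) * c)"
  proof (rule integral_norm_bound_integral)
    show "(\<lambda>t. rhoJ t (y t)) integrable_on {0..x}"
      using absolutely_integrable_on_Icc_subset[OF rhoJ_integrable[OF y], of 0 x] x
      by (auto intro: integrable_on_of_abs)
    show "norm (rhoJ t (y t)) \<le> 2 * (1 + \<alpha>) * c" if "t \<in> {0..x}" for t
      using le[of t] that x rho_le[of t] rho_pos[of t] \<alpha>
      by (intro order_trans[OF norm_rhoJ_le] mult_mono) auto
  qed auto
  also have "\<dots> = 2 * (1 + \<alpha>) * c * x" using x by simp
  also have "\<dots> \<le> 2 * (1 + \<alpha>) * c * pi"
    using x c \<alpha> by (intro mult_left_mono) auto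
  finally show ?thesis .
qed

lemma dirac_volterra:
  assumes "cmod \<mu> \<le> R"
  shows "volterra 0 pi (dirac \<mu>) (dirac_bound R)"
proof
  have R: "0 \<le> R" using assms norm_ge_zero order_trans by blast
  show "dirac_bound R absolutely_integrable_on {0..pi}"
    unfolding dirac_bound_def
    using absolutely_integrable_norm[OF in_L2_absolutely_integrable[OF p_L2]]
      absolutely_integrable_norm[OF in_L2_absolutely_integrable[OF q_L2]]
    by (intro set_integrable_mult_right set_integral_add impI rho_integrable) (auto simp: o_def)
  show "0 \<le> dirac_bound R t" for t
    using R rho_pos[of t] by (simp add: dirac_bound_def)
  show "(\<lambda>t. dirac \<mu> t (y t)) absolutely_integrable_on {0..pi}" if "continuous_on {0..pi} y" for y
  proof -
    have "(\<lambda>t. dirac \<mu> t (y t)) = (\<lambda>t. vector [q t * y t $ 1 - p t * y t $ 2 - \<mu> * (\<rho> t * y t $ 2),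
        - (p t * y t $ 1) - q t * y t $ 2 + \<mu> * (\<rho> t * y t $ 1)])"
      by (intro ext) (simp add: dirac_def rhoJ_def complex2_eq_iff)
    then show ?thesis
      using that
      by (simp only:) (intro absolutely_integrable_vector2 set_integral_add set_integral_diff
          set_integrable_mult_right impI absolutely_integrable_mult_continuous absolutely_integrable_minus
          coefficient_integrable continuous_intros)
  qed
  show "dirac \<mu> t (u - v) = dirac \<mu> t u - dirac \<mu> t v" for t u v
    by (simp add: dirac_def rhoJ_def complex2_eq_iff algebra_simps)
  show "norm (dirac \<mu> t v) \<le> dirac_bound R t * norm v" for t v
  proof -
    let ?w = "vector [q t * v $ 1 - p t * v $ 2, - (p t * v $ 1) - q t * v $ 2] :: complex^2"
    have n: "cmod (v $ i) \<le> norm v" for i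
      by (rule Finite_Cartesian_Product.norm_nth_le)
    have "norm ?w \<le> cmod (q t * v $ 1 - p t * v $ 2) + cmod (- (p t * v $ 1) - q t * v $ 2)"
      using norm_complex2_le[of ?w] by simp
    also have "\<dots> \<le> (\<bar>q t\<bar> * norm v + \<bar>p t\<bar> * norm v) + (\<bar>p t\<bar> * norm v + \<bar>q t\<bar> * norm v)"
    proof (intro add_mono)
      show "cmod (q t * v $ 1 - p t * v $ 2) \<le> \<bar>q t\<bar> * norm v + \<bar>p t\<bar> * norm v"
        using n by (intro order_trans[OF norm_triangle_ineq4] add_mono) (auto simp: norm_mult intro: mult_left_mono)
      show "cmod (- (p t * v $ 1) - q t * v $ 2) \<le> \<bar>p t\<bar> * norm v + \<bar>q t\<bar> * norm v"
        using n by (intro order_trans[OF norm_triangle_ineq4] add_mono) (auto simp: norm_mult intro: mult_left_mono)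
    qed
    finally have 1: "norm ?w \<le> 2 * (\<bar>p t\<bar> + \<bar>q t\<bar>) * norm v"
      by (simp add: algebra_simps)
    have 2: "norm (\<mu> *s rhoJ t v) \<le> R * (2 * rho a \<alpha> t * norm v)"
      using assms norm_rhoJ_le[of t v] R by (simp only: norm_vector_scalar_mult) (intro mult_mono, auto)
    show ?thesis
      using norm_triangle_le[OF add_mono[OF 1 2]]
      by (simp add: dirac_def dirac_bound_def algebra_simps)
  qed
qed

lemma dirac_integrable:
  "continuous_on {0..pi} y \<Longrightarrow> (\<lambda>t. dirac \<mu> t (y t)) absolutely_integrable_on {0..pi}"
  using volterra.K_int[OF dirac_volterra[OF order_refl]] .

lemma is_solution_imp_integral_equation:
  assumes "is_solution a \<alpha> p q \<mu> y"
  shows "continuous_on {0..pi} y"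
    and "x \<in> {0..pi} \<Longrightarrow> y x = y 0 + integral {0..x} (\<lambda>t. dirac \<mu> t (y t))"
proof -
  obtain y' where y': "integrable (lebesgue_on {0..pi}) y'"
    and y: "\<And>x. x \<in> {0..pi} \<Longrightarrow> y x = y 0 + (LINT t|lebesgue_on {0..x}. y' t)"
    and ae: "AE x in lebesgue_on {0<..<pi}. B_mat *v y' x + Omega p q x *v y x = (\<mu> * \<rho> x) *s y x"
    using assms unfolding is_solution_def has_ac_derivative_def by blast
  obtain N where N: "negligible N" "\<And>x. x \<in> {0..pi} - N \<Longrightarrow>
      B_mat *v y' x + Omega p q x *v y x = (\<mu> * \<rho> x) *s y x"
    using AE_Ioo_imp_negligible[OF ae] by blast
  have rhoJ0: "rhoJ t 0 = 0" for t by (simp add: rhoJ_def complex2_eq_iff)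
  have eq': "y' t = dirac \<mu> t (y t)" if "t \<in> {0..pi} - N" for t
    using N(2)[OF that] dirac_equation_iff[of "y' t" t "y t" \<mu> 0] by (simp add: rhoJ0)
  have *: "(LINT t|lebesgue_on {0..x}. y' t) = integral {0..x} y'" if "x \<in> {0..pi}" for x
    using that integrable_subinterval[OF y', of 0 x] by (intro lebesgue_integral_eq_integral) auto
  show c: "continuous_on {0..pi} y"
    using indefinite_integral_continuous_real[OF y']
    by (subst continuous_on_cong[OF refl y]) (auto intro!: continuous_intros)
  show "y x = y 0 + integral {0..x} (\<lambda>t. dirac \<mu> t (y t))" if x: "x \<in> {0..pi}"
  proof -
    have "integral {0..x} y' = integral {0..x} (\<lambda>t. dirac \<mu> t (y t))"
      using x eq' by (intro integral_spike[OF N(1)]) auto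
    then show ?thesis using y[OF x] *[OF x] by simp
  qed
qed

text \<open>The integrated form of the inhomogeneous system \<open>B y' + \<Omega> y = \<mu> \<rho> y + \<rho> z\<close>; see
  \<open>dirac_equation_iff\<close>.\<close>

definition solves :: "complex \<Rightarrow> (real \<Rightarrow> complex^2) \<Rightarrow> (real \<Rightarrow> complex^2) \<Rightarrow> bool" where
  "solves \<mu> z y \<longleftrightarrow> continuous_on {0..pi} y \<and>
     (\<forall>x\<in>{0..pi}. y x = y 0 + integral {0..x} (\<lambda>t. dirac \<mu> t (y t) + rhoJ t (z t)))"

lemma solves_add_scale:
  assumes y: "solves \<mu> z y" and v: "solves \<mu> (\<lambda>_. 0) v" and z: "z absolutely_integrable_on {0..pi}"
  shows "solves \<mu> z (\<lambda>t. y t + c *s v t)"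
proof -
  have cy: "continuous_on {0..pi} y" and cv: "continuous_on {0..pi} v"
    using y v by (auto simp: solves_def)
  have "y x + c *s v x = (y 0 + c *s v 0)
      + integral {0..x} (\<lambda>t. dirac \<mu> t (y t + c *s v t) + rhoJ t (z t))" if x: "x \<in> {0..pi}" for x
  proof -
    have sub: "g absolutely_integrable_on {0..x}" if "g absolutely_integrable_on {0..pi}" for g :: "real \<Rightarrow> complex^2"
      using absolutely_integrable_on_Icc_subset[OF that, of 0 x] x by auto
    have 1: "(\<lambda>t. dirac \<mu> t (y t) + rhoJ t (z t)) integrable_on {0..x}"
      by (intro integrable_on_of_abs sub set_integral_add dirac_integrable rhoJ_integrable_L1 cy z)
    have dv: "(\<lambda>t. dirac \<mu> t (v t)) absolutely_integrable_on {0..x}"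
      by (intro sub dirac_integrable cv)
    have 2: "(\<lambda>t. c *s dirac \<mu> t (v t)) integrable_on {0..x}"
      by (intro integrable_on_of_abs absolutely_integrable_vector_scalar_mult dv)
    have "(\<lambda>t. dirac \<mu> t (y t + c *s v t) + rhoJ t (z t))
        = (\<lambda>t. (dirac \<mu> t (y t) + rhoJ t (z t)) + c *s dirac \<mu> t (v t))"
      by (simp add: fun_eq_iff dirac_def rhoJ_def complex2_eq_iff algebra_simps)
    then have "integral {0..x} (\<lambda>t. dirac \<mu> t (y t + c *s v t) + rhoJ t (z t))
        = integral {0..x} (\<lambda>t. dirac \<mu> t (y t) + rhoJ t (z t)) + c *s integral {0..x} (\<lambda>t. dirac \<mu> t (v t))"
      by (simp only: Henstock_Kurzweil_Integration.integral_add[OF 1 2] integral_vector_scalar_mult[OF dv])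
    moreover have "y x = y 0 + integral {0..x} (\<lambda>t. dirac \<mu> t (y t) + rhoJ t (z t))"
      using y x unfolding solves_def by blast
    moreover have "v x = v 0 + integral {0..x} (\<lambda>t. dirac \<mu> t (v t))"
      using v x unfolding solves_def rhoJ_0 add_0_right by blast
    ultimately show ?thesis
      by (simp only: vector_add_ldistrib ac_simps)
  qed
  moreover have "continuous_on {0..pi} (\<lambda>t. y t + c *s v t)"
    by (intro continuous_intros continuous_on_vector_scalar_mult cy cv)
  ultimately show ?thesis
    unfolding solves_def by blast
qed

end

section \<open>Holomorphic dependence on the spectral parameter\<close>

context dirac_system
begin

text \<open>A solution whose initial value is affine in \<open>\<mu>\<close> is differentiable in \<open>\<mu>\<close>, uniformly in \<open>x\<close>.  The candidate
  \<open>v\<close> for the derivative solves the formally differentiated equation.  Both the difference \<open>\<delta>\<close> of two solutions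
  and the remainder \<open>r = \<delta> - (\<mu> - \<kappa>) v\<close> solve Volterra equations with the kernel for \<open>\<kappa>\<close>, with
  inhomogeneities of order \<open>\<bar>\<mu> - \<kappa>\<bar>\<close> and \<open>\<bar>\<mu> - \<kappa>\<bar>\<^sup>2\<close> respectively, so Gronwall's inequality bounds
  them.\<close>

lemma parameter_derivative:
  fixes y :: "complex \<Rightarrow> real \<Rightarrow> complex^2"
  assumes cy: "\<And>\<mu>. continuous_on {0..pi} (y \<mu>)" and F: "continuous_on {0..pi} F"
    and eq: "\<And>\<mu> x. x \<in> {0..pi} \<Longrightarrow>
               y \<mu> x = u0 + \<mu> *s u1 + F x + integral {0..x} (\<lambda>t. dirac \<mu> t (y \<mu> t))"
  obtains v C where "continuous_on {0..pi} v"
    "\<And>\<mu> x. cmod (\<mu> - \<kappa>) \<le> 1 \<Longrightarrow> x \<in> {0..pi} \<Longrightarrow>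
       norm (y \<mu> x - y \<kappa> x - (\<mu> - \<kappa>) *s v x) \<le> C * (cmod (\<mu> - \<kappa>))\<^sup>2"
proof -
  define R where "R = cmod \<kappa> + 1"
  interpret V: volterra 0 pi "dirac \<kappa>" "dirac_bound R"
    by (rule dirac_volterra) (simp add: R_def)
  have sub: "f integrable_on {0..x}" if "f absolutely_integrable_on {0..pi}" "x \<in> {0..pi}"
    for f :: "real \<Rightarrow> complex^2" and x
    using absolutely_integrable_on_Icc_subset[OF that(1), of 0 x] that(2) by (auto intro: integrable_on_of_abs)
  have "bounded (F ` {0..pi})"
    by (intro compact_imp_bounded compact_continuous_image F) auto
  then obtain G where G: "G > 0" "\<And>x. x \<in> {0..pi} \<Longrightarrow> norm (F x) \<le> G"
    unfolding bounded_pos by auto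
  define E where "E = exp (2 * integral {0..pi} (dirac_bound R))"
  \<comment> \<open>\<open>C1\<close> bounds the solutions near \<open>\<kappa>\<close>, \<open>C2\<close> their difference quotients, \<open>C3\<close> the quadratic remainder.\<close>
  define C1 where "C1 = 2 * (norm u0 + R * norm u1 + G) * E"
  have y_bound: "norm (y \<mu> x) \<le> C1" if "cmod (\<mu> - \<kappa>) \<le> 1" "x \<in> {0..pi}" for \<mu> x
  proof -
    have \<mu>: "cmod \<mu> \<le> R"
      using norm_triangle_ineq[of "\<mu> - \<kappa>" \<kappa>] that by (simp add: R_def)
    interpret W: volterra 0 pi "dirac \<mu>" "dirac_bound R"
      by (rule dirac_volterra[OF \<mu>])
    show ?thesis
      unfolding C1_def E_def
    proof (rule W.solution_bound[OF cy _ _ that(2)])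
      show "y \<mu> x = (u0 + \<mu> *s u1 + F x) + integral {0..x} (\<lambda>t. dirac \<mu> t (y \<mu> t))" if "x \<in> {0..pi}" for x
        using eq[OF that] by simp
      show "norm (u0 + \<mu> *s u1 + F x) \<le> norm u0 + R * norm u1 + G" if "x \<in> {0..pi}" for x
        using G(2)[OF that] mult_right_mono[OF \<mu>, of "norm u1"]
        by (intro norm_triangle_le add_mono) auto
    qed
  qed
  have "continuous_on {0..pi} (\<lambda>x. u1 + integral {0..x} (\<lambda>t. rhoJ t (y \<kappa> t)))"
    by (intro continuous_intros continuous_on_indefinite_integral rhoJ_integrable cy)
  then obtain v where cv: "continuous_on {0..pi} v"
    and v: "\<And>x. x \<in> {0..pi} \<Longrightarrow>
      v x = u1 + integral {0..x} (\<lambda>t. rhoJ t (y \<kappa> t)) + integral {0..x} (\<lambda>t. dirac \<kappa> t (v t))"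
    by (rule V.solution_exists) blast
  define C2 where "C2 = 2 * (norm u1 + 2 * (1 + \<alpha>) * C1 * pi) * E"
  define C3 where "C3 = 2 * (2 * (1 + \<alpha>) * C2 * pi) * E"
  have main: "norm (y \<mu> x - y \<kappa> x - (\<mu> - \<kappa>) *s v x) \<le> C3 * (cmod (\<mu> - \<kappa>))\<^sup>2"
    if \<mu>: "cmod (\<mu> - \<kappa>) \<le> 1" and x: "x \<in> {0..pi}" for \<mu> x
  proof -
    define \<delta> where "\<delta> t = y \<mu> t - y \<kappa> t" for t
    define r where "r t = \<delta> t - (\<mu> - \<kappa>) *s v t" for t
    have c\<delta>: "continuous_on {0..pi} \<delta>"
      unfolding \<delta>_def by (intro continuous_intros cy)
    have cr: "continuous_on {0..pi} r"
      unfolding r_def by (intro continuous_intros c\<delta> continuous_on_vector_scalar_mult cv)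
    have \<delta>_eq: "\<delta> x = (\<mu> - \<kappa>) *s (u1 + integral {0..x} (\<lambda>t. rhoJ t (y \<mu> t))) + integral {0..x} (\<lambda>t. dirac \<kappa> t (\<delta> t))"
      if x: "x \<in> {0..pi}" for x
    proof -
      have "integral {0..x} (\<lambda>t. dirac \<mu> t (y \<mu> t))
          = integral {0..x} (\<lambda>t. dirac \<kappa> t (y \<mu> t)) + integral {0..x} (\<lambda>t. (\<mu> - \<kappa>) *s rhoJ t (y \<mu> t))"
        unfolding dirac_parameter[of \<mu> _ _ \<kappa>]
        by (intro Henstock_Kurzweil_Integration.integral_add sub dirac_integrable cy x absolutely_integrable_vector_scalar_mult rhoJ_integrable)
      also have "integral {0..x} (\<lambda>t. (\<mu> - \<kappa>) *s rhoJ t (y \<mu> t)) = (\<mu> - \<kappa>) *s integral {0..x} (\<lambda>t. rhoJ t (y \<mu> t))"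
        by (intro integral_vector_scalar_mult absolutely_integrable_on_Icc_subset[OF rhoJ_integrable[OF cy]]) (use x in auto)
      finally show ?thesis
        unfolding \<delta>_def V.K_integral_diff[OF cy cy x, symmetric]
        by (simp add: eq[OF x] vector_add_ldistrib vector_sub_rdistrib)
    qed
    have \<delta>_bound: "norm (\<delta> x) \<le> C2 * cmod (\<mu> - \<kappa>)" if "x \<in> {0..pi}" for x
    proof -
      have "norm (\<delta> x) \<le> 2 * (cmod (\<mu> - \<kappa>) * (norm u1 + 2 * (1 + \<alpha>) * C1 * pi)) * exp (2 * integral {0..pi} (dirac_bound R))"
      proof (rule V.solution_bound[OF c\<delta> \<delta>_eq _ that])
        show "norm ((\<mu> - \<kappa>) *s (u1 + integral {0..x} (\<lambda>t. rhoJ t (y \<mu> t)))) \<le> cmod (\<mu> - \<kappa>) * (norm u1 + 2 * (1 + \<alpha>) * C1 * pi)"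
          if "x \<in> {0..pi}" for x
          unfolding norm_vector_scalar_mult
          using integral_rhoJ_bound[OF cy y_bound[OF \<mu>] that]
          by (intro mult_left_mono norm_triangle_le add_mono) auto
      qed
      then show ?thesis unfolding C2_def E_def by (simp only: mult_ac)
    qed
    have r_eq: "r x = (\<mu> - \<kappa>) *s integral {0..x} (\<lambda>t. rhoJ t (\<delta> t)) + integral {0..x} (\<lambda>t. dirac \<kappa> t (r t))"
      if x: "x \<in> {0..pi}" for x
    proof -
      have 1: "integral {0..x} (\<lambda>t. rhoJ t (\<delta> t)) = integral {0..x} (\<lambda>t. rhoJ t (y \<mu> t)) - integral {0..x} (\<lambda>t. rhoJ t (y \<kappa> t))"
        unfolding \<delta>_def rhoJ_diff by (intro Henstock_Kurzweil_Integration.integral_diff sub rhoJ_integrable cy x)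
      have 2: "integral {0..x} (\<lambda>t. dirac \<kappa> t (r t)) = integral {0..x} (\<lambda>t. dirac \<kappa> t (\<delta> t)) - (\<mu> - \<kappa>) *s integral {0..x} (\<lambda>t. dirac \<kappa> t (v t))"
        unfolding r_def V.K_integral_diff[OF c\<delta> continuous_on_vector_scalar_mult[OF cv] x, symmetric] dirac_scale
        using x by (subst integral_vector_scalar_mult) (auto intro: absolutely_integrable_on_Icc_subset[OF dirac_integrable[OF cv]])
      have "r x = \<delta> x - (\<mu> - \<kappa>) *s v x" by (simp add: r_def)
      also have "\<dots> = (\<mu> - \<kappa>) *s integral {0..x} (\<lambda>t. rhoJ t (\<delta> t)) + integral {0..x} (\<lambda>t. dirac \<kappa> t (r t))"
        unfolding 1 2 \<delta>_eq[OF x] v[OF x] by (simp add: vector_add_ldistrib vector_ssub_ldistrib)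
      finally show ?thesis .
    qed
    have "norm (r x) \<le> 2 * (cmod (\<mu> - \<kappa>) * (2 * (1 + \<alpha>) * (C2 * cmod (\<mu> - \<kappa>)) * pi)) * exp (2 * integral {0..pi} (dirac_bound R))"
    proof (rule V.solution_bound[OF cr r_eq _ x])
      show "norm ((\<mu> - \<kappa>) *s integral {0..x} (\<lambda>t. rhoJ t (\<delta> t))) \<le> cmod (\<mu> - \<kappa>) * (2 * (1 + \<alpha>) * (C2 * cmod (\<mu> - \<kappa>)) * pi)"
        if "x \<in> {0..pi}" for x
        unfolding norm_vector_scalar_mult
        using integral_rhoJ_bound[OF c\<delta> \<delta>_bound that] by (intro mult_left_mono) auto
    qed
    then show ?thesis unfolding C3_def E_def r_def \<delta>_def power2_eq_square by (simp only: mult_ac)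
  qed
  show thesis using that[OF cv main] by blast
qed

text \<open>Uniform differentiability passes through every functional \<open>L\<close> that is complex linear and bounded in the
  supremum norm.  Point evaluations and integrals against integrable functions are the instances used.\<close>

lemma holomorphic_functional:
  fixes y :: "complex \<Rightarrow> real \<Rightarrow> complex^2"
  assumes cy: "\<And>\<mu>. continuous_on {0..pi} (y \<mu>)" and F: "continuous_on {0..pi} F"
    and eq: "\<And>\<mu> x. x \<in> {0..pi} \<Longrightarrow>
               y \<mu> x = u0 + \<mu> *s u1 + F x + integral {0..x} (\<lambda>t. dirac \<mu> t (y \<mu> t))"
    and L_diff: "\<And>f g. continuous_on {0..pi} f \<Longrightarrow> continuous_on {0..pi} g \<Longrightarrow> L (\<lambda>t. f t - g t) = L f - L g"
    and L_scale: "\<And>f c. continuous_on {0..pi} f \<Longrightarrow> L (\<lambda>t. c *s f t) = c * L f"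
    and L_bound: "\<And>f B. continuous_on {0..pi} f \<Longrightarrow> (\<And>x. x \<in> {0..pi} \<Longrightarrow> norm (f x) \<le> B) \<Longrightarrow> cmod (L f) \<le> M * B"
  shows "(\<lambda>\<mu>. L (y \<mu>)) holomorphic_on UNIV"
  unfolding holomorphic_on_open[OF open_UNIV]
proof (intro ballI)
  fix \<kappa> :: complex
  obtain v C where cv: "continuous_on {0..pi} v" and v: "\<And>\<mu> x. cmod (\<mu> - \<kappa>) \<le> 1 \<Longrightarrow> x \<in> {0..pi} \<Longrightarrow>
       norm (y \<mu> x - y \<kappa> x - (\<mu> - \<kappa>) *s v x) \<le> C * (cmod (\<mu> - \<kappa>))\<^sup>2"
    using parameter_derivative[OF cy F eq] by blast
  have le: "cmod ((L (y \<mu>) - L (y \<kappa>)) / (\<mu> - \<kappa>) - L v) \<le> M * C * cmod (\<mu> - \<kappa>)"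
    if \<mu>: "cmod (\<mu> - \<kappa>) \<le> 1" "\<mu> \<noteq> \<kappa>" for \<mu>
  proof -
    have "cmod (L (\<lambda>t. (y \<mu> t - y \<kappa> t) - (\<mu> - \<kappa>) *s v t)) \<le> M * (C * (cmod (\<mu> - \<kappa>))\<^sup>2)"
      using v[OF \<mu>(1)] by (intro L_bound continuous_intros continuous_on_vector_scalar_mult cy cv) auto
    also have "L (\<lambda>t. (y \<mu> t - y \<kappa> t) - (\<mu> - \<kappa>) *s v t) = L (y \<mu>) - L (y \<kappa>) - (\<mu> - \<kappa>) * L v"
      unfolding L_diff[OF continuous_on_diff[OF cy cy] continuous_on_vector_scalar_mult[OF cv]]
        L_diff[OF cy cy] L_scale[OF cv] ..
    also have "\<dots> = (\<mu> - \<kappa>) * ((L (y \<mu>) - L (y \<kappa>)) / (\<mu> - \<kappa>) - L v)"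
      using \<mu>(2) by (simp add: field_simps)
    finally show ?thesis
      using \<mu>(2) by (simp add: norm_mult power2_eq_square)
  qed
  have "((\<lambda>\<mu>. (L (y \<mu>) - L (y \<kappa>)) / (\<mu> - \<kappa>) - L v) \<longlongrightarrow> 0) (at \<kappa>)"
  proof (rule Lim_null_comparison)
    show "\<forall>\<^sub>F \<mu> in at \<kappa>. norm ((L (y \<mu>) - L (y \<kappa>)) / (\<mu> - \<kappa>) - L v) \<le> M * C * cmod (\<mu> - \<kappa>)"
      unfolding eventually_at using le by (intro exI[of _ 1]) (auto simp: dist_norm)
    show "((\<lambda>\<mu>. M * C * cmod (\<mu> - \<kappa>)) \<longlongrightarrow> 0) (at \<kappa>)"
      by (auto intro!: tendsto_eq_intros)
  qed
  then show "\<exists>f'. ((\<lambda>\<mu>. L (y \<mu>)) has_field_derivative f') (at \<kappa>)"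
    unfolding has_field_derivative_iff LIM_zero_iff by blast
qed

lemma holomorphic_eval:
  fixes y :: "complex \<Rightarrow> real \<Rightarrow> complex^2"
  assumes cy: "\<And>\<mu>. continuous_on {0..pi} (y \<mu>)" and F: "continuous_on {0..pi} F"
    and eq: "\<And>\<mu> x. x \<in> {0..pi} \<Longrightarrow>
               y \<mu> x = u0 + \<mu> *s u1 + F x + integral {0..x} (\<lambda>t. dirac \<mu> t (y \<mu> t))"
    and x: "x \<in> {0..pi}"
  shows "(\<lambda>\<mu>. y \<mu> x $ i) holomorphic_on UNIV"
proof (rule holomorphic_functional[where L = "\<lambda>f. f x $ i" and M = 1, OF cy F eq])
  show "cmod (f x $ i) \<le> 1 * B" if "\<And>x. x \<in> {0..pi} \<Longrightarrow> norm (f x) \<le> B" for f :: "real \<Rightarrow> complex^2" and B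
    using order_trans[OF Finite_Cartesian_Product.norm_nth_le that[OF x]] by simp
qed auto

lemma holomorphic_integral:
  fixes y :: "complex \<Rightarrow> real \<Rightarrow> complex^2"
  assumes cy: "\<And>\<mu>. continuous_on {0..pi} (y \<mu>)" and F: "continuous_on {0..pi} F"
    and eq: "\<And>\<mu> x. x \<in> {0..pi} \<Longrightarrow>
               y \<mu> x = u0 + \<mu> *s u1 + F x + integral {0..x} (\<lambda>t. dirac \<mu> t (y \<mu> t))"
    and g: "g absolutely_integrable_on {0..pi}" and x: "x \<in> {0..pi}"
  shows "(\<lambda>\<mu>. integral {0..x} (\<lambda>t. g t * y \<mu> t $ i)) holomorphic_on UNIV"
proof -
  have int: "(\<lambda>t. g t * f t $ i) integrable_on {0..x}" if "continuous_on {0..pi} f" for f :: "real \<Rightarrow> complex^2"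
  proof -
    have "(\<lambda>t. g t * f t $ i) absolutely_integrable_on {0..pi}"
      by (intro absolutely_integrable_mult_continuous g continuous_intros that)
    from absolutely_integrable_on_Icc_subset[OF this, of 0 x] x show ?thesis
      by (auto intro: integrable_on_of_abs)
  qed
  have gn: "(\<lambda>t. norm (g t)) integrable_on {0..x}"
    using absolutely_integrable_norm[OF absolutely_integrable_on_Icc_subset[OF g, of 0 x]] x
    by (auto simp: o_def intro: integrable_on_of_abs)
  show ?thesis
  proof (rule holomorphic_functional[where L = "\<lambda>f. integral {0..x} (\<lambda>t. g t * f t $ i)"
        and M = "integral {0..x} (\<lambda>t. norm (g t))", OF cy F eq])
    fix f h :: "real \<Rightarrow> complex^2" assume "continuous_on {0..pi} f" "continuous_on {0..pi} h"
    then show "integral {0..x} (\<lambda>t. g t * (f t - h t) $ i)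
        = integral {0..x} (\<lambda>t. g t * f t $ i) - integral {0..x} (\<lambda>t. g t * h t $ i)"
      unfolding vector_minus_component right_diff_distrib
      by (intro Henstock_Kurzweil_Integration.integral_diff int)
  next
    fix f :: "real \<Rightarrow> complex^2" and c
    show "integral {0..x} (\<lambda>t. g t * (c *s f t) $ i) = c * integral {0..x} (\<lambda>t. g t * f t $ i)"
    proof -
      have "(\<lambda>t. g t * (c *s f t) $ i) = (\<lambda>t. c * (g t * f t $ i))"
        by (simp add: fun_eq_iff)
      then show ?thesis by simp
    qed
  next
    fix f :: "real \<Rightarrow> complex^2" and B
    assume f: "continuous_on {0..pi} f" and B: "\<And>x. x \<in> {0..pi} \<Longrightarrow> norm (f x) \<le> B"
    have "cmod (integral {0..x} (\<lambda>t. g t * f t $ i)) \<le> integral {0..x} (\<lambda>t. norm (g t) * B)"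
    proof (rule integral_norm_bound_integral[OF int[OF f]])
      show "(\<lambda>t. norm (g t) * B) integrable_on {0..x}"
        using gn by (rule integrable_on_mult_left)
      show "cmod (g t * f t $ i) \<le> norm (g t) * B" if "t \<in> {0..x}" for t
        using order_trans[OF Finite_Cartesian_Product.norm_nth_le B] that x
        by (auto simp: norm_mult intro!: mult_left_mono)
    qed
    then show "cmod (integral {0..x} (\<lambda>t. g t * f t $ i)) \<le> integral {0..x} (\<lambda>t. norm (g t)) * B"
      by simp
  qed
qed

end

section \<open>Lagrange identity\<close>

context dirac_system
begin

lemma weighted_cdot_integrable:
  assumes "z absolutely_integrable_on {0..pi}" "continuous_on {0..pi} v"
  shows "(\<lambda>t. \<rho> t * cdot (z t) (v t)) absolutely_integrable_on {0..pi}"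
    "(\<lambda>t. \<rho> t * cdot (v t) (z t)) absolutely_integrable_on {0..pi}"
  unfolding cdot_def
  by (intro rho_mult_integrable set_integral_add absolutely_integrable_mult_continuous
      absolutely_integrable_continuous_mult
      absolutely_integrable_vec_nth absolutely_integrable_cnj continuous_intros assms)+

text \<open>Integration by parts for \<open>y\<^sub>2 cnj v\<^sub>1 - y\<^sub>1 cnj v\<^sub>2\<close>.  The coefficients \<open>p\<close> and \<open>q\<close> drop out since \<open>\<Omega>\<close> is
  real and symmetric.\<close>

lemma green_formula:
  assumes y: "solves \<kappa> z y" and v: "solves \<mu> x v"
    and z: "z absolutely_integrable_on {0..pi}" and x: "x absolutely_integrable_on {0..pi}"
  shows "(y pi $ 2 * cnj (v pi $ 1) - y pi $ 1 * cnj (v pi $ 2))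
       - (y 0 $ 2 * cnj (v 0 $ 1) - y 0 $ 1 * cnj (v 0 $ 2))
     = (\<kappa> - cnj \<mu>) * integral {0..pi} (\<lambda>t. \<rho> t * cdot (y t) (v t))
       + integral {0..pi} (\<lambda>t. \<rho> t * cdot (z t) (v t))
       - integral {0..pi} (\<lambda>t. \<rho> t * cdot (y t) (x t))"
proof -
  define y' where "y' t = dirac \<kappa> t (y t) + rhoJ t (z t)" for t
  define v' where "v' t = dirac \<mu> t (v t) + rhoJ t (x t)" for t
  have cy: "continuous_on {0..pi} y" and cv: "continuous_on {0..pi} v"
    using y v by (auto simp: solves_def)
  have ai: "y' absolutely_integrable_on {0..pi}" "v' absolutely_integrable_on {0..pi}"
    unfolding y'_def v'_def by (intro set_integral_add dirac_integrable rhoJ_integrable_L1 cy cv x z)+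
  have yi: "y s $ i = y 0 $ i + integral {0..s} (\<lambda>t. y' t $ i)" if "s \<in> {0..pi}" for s i
  proof -
    have "y s = y 0 + integral {0..s} y'" using y that unfolding solves_def y'_def[abs_def] by blast
    moreover have "integral {0..s} y' $ i = integral {0..s} (\<lambda>t. y' t $ i)"
      using that by (intro integral_vec_nth absolutely_integrable_on_Icc_subset[OF ai(1)]) auto
    ultimately show ?thesis by (metis vector_add_component)
  qed
  have vi: "cnj (v s $ i) = cnj (v 0 $ i) + integral {0..s} (\<lambda>t. cnj (v' t $ i))" if "s \<in> {0..pi}" for s i
  proof -
    have "v s = v 0 + integral {0..s} v'" using v that unfolding solves_def v'_def[abs_def] by blast
    moreover have "integral {0..s} v' $ i = integral {0..s} (\<lambda>t. v' t $ i)"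
      using that by (intro integral_vec_nth absolutely_integrable_on_Icc_subset[OF ai(2)]) auto
    ultimately have "v s $ i = v 0 $ i + integral {0..s} (\<lambda>t. v' t $ i)"
      by (metis vector_add_component)
    then show ?thesis by (simp add: integral_cnj)
  qed
  have pr: "integral {0..pi} (\<lambda>t. y' t $ i * cnj (v t $ j) + y t $ i * cnj (v' t $ j))
      = y pi $ i * cnj (v pi $ j) - y 0 $ i * cnj (v 0 $ j)" for i j
    by (rule integral_product_rule[where a = 0 and b = pi,
          OF absolutely_integrable_vec_nth[OF ai(1)]
            absolutely_integrable_cnj[OF absolutely_integrable_vec_nth[OF ai(2)]] yi vi]) auto
  have int: "(\<lambda>t. y' t $ i * cnj (v t $ j) + y t $ i * cnj (v' t $ j)) integrable_on {0..pi}" for i j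
    by (intro integrable_on_of_abs set_integral_add absolutely_integrable_mult_continuous
        absolutely_integrable_continuous_mult
        absolutely_integrable_vec_nth absolutely_integrable_cnj continuous_intros ai cy cv)
  have ints: "(\<lambda>t. \<rho> t * cdot (y t) (v t)) integrable_on {0..pi}"
      "(\<lambda>t. \<rho> t * cdot (z t) (v t)) integrable_on {0..pi}"
      "(\<lambda>t. \<rho> t * cdot (y t) (x t)) integrable_on {0..pi}"
    using weighted_cdot_integrable[OF z cv] weighted_cdot_integrable[OF x cy]
      weighted_cdot_integrable[OF absolutely_integrable_continuous_real[OF cy] cv]
    by (auto intro: integrable_on_of_abs)
  note int1 = integrable_on_mult_right[OF ints(1), of "\<kappa> - cnj \<mu>"]
  have pointwise: "(y' t $ 2 * cnj (v t $ 1) + y t $ 2 * cnj (v' t $ 1))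
        - (y' t $ 1 * cnj (v t $ 2) + y t $ 1 * cnj (v' t $ 2))
      = (\<kappa> - cnj \<mu>) * (\<rho> t * cdot (y t) (v t)) + \<rho> t * cdot (z t) (v t) - \<rho> t * cdot (y t) (x t)" for t
    by (simp add: y'_def v'_def dirac_def rhoJ_def cdot_def algebra_simps)
  have "(y pi $ 2 * cnj (v pi $ 1) - y 0 $ 2 * cnj (v 0 $ 1)) - (y pi $ 1 * cnj (v pi $ 2) - y 0 $ 1 * cnj (v 0 $ 2))
     = integral {0..pi} (\<lambda>t. (y' t $ 2 * cnj (v t $ 1) + y t $ 2 * cnj (v' t $ 1))
        - (y' t $ 1 * cnj (v t $ 2) + y t $ 1 * cnj (v' t $ 2)))"
    by (rule trans[OF _ Henstock_Kurzweil_Integration.integral_diff[OF int[of 2 1] int[of 1 2], symmetric]])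
      (rule arg_cong2[where f = "(-)", OF pr[of 2 1, symmetric] pr[of 1 2, symmetric]])
  also have "\<dots> = integral {0..pi} (\<lambda>t. (\<kappa> - cnj \<mu>) * (\<rho> t * cdot (y t) (v t)) + \<rho> t * cdot (z t) (v t)
      - \<rho> t * cdot (y t) (x t))"
    by (rule arg_cong[where f = "integral {0..pi}"]) (rule ext, rule pointwise)
  also have "\<dots> = (\<kappa> - cnj \<mu>) * integral {0..pi} (\<lambda>t. \<rho> t * cdot (y t) (v t))
      + integral {0..pi} (\<lambda>t. \<rho> t * cdot (z t) (v t)) - integral {0..pi} (\<lambda>t. \<rho> t * cdot (y t) (x t))"
    unfolding Henstock_Kurzweil_Integration.integral_diff[OF
        Henstock_Kurzweil_Integration.integrable_add[OF int1 ints(2)] ints(3)]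
      Henstock_Kurzweil_Integration.integral_add[OF int1 ints(2)] integral_mult_right ..
  finally have "(y pi $ 2 * cnj (v pi $ 1) - y 0 $ 2 * cnj (v 0 $ 1)) - (y pi $ 1 * cnj (v pi $ 2) - y 0 $ 1 * cnj (v 0 $ 2))
      = (\<kappa> - cnj \<mu>) * integral {0..pi} (\<lambda>t. \<rho> t * cdot (y t) (v t))
      + integral {0..pi} (\<lambda>t. \<rho> t * cdot (z t) (v t)) - integral {0..pi} (\<lambda>t. \<rho> t * cdot (y t) (x t))" .
  moreover have "(A - B) - (C - D) = (A - C) - (B - D)" for A B C D :: complex
    by simp
  ultimately show ?thesis by (rule trans[rotated])
qed

text \<open>On a bounded interval square integrable functions are integrable, and \<open>\<rho>\<close> is bounded away from zero.\<close>

lemma hspace_integrable: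
  assumes "(z, z3, z4) \<in> hspace a \<alpha>"
  shows "z absolutely_integrable_on {0..pi}"
    and "(\<lambda>t. (norm (z t))\<^sup>2 * rho a \<alpha> t) absolutely_integrable_on {0..pi}"
proof -
  let ?e = "\<lambda>t. (norm (z t))\<^sup>2 * rho a \<alpha> t"
  have zm: "z \<in> borel_measurable (lebesgue_on {0<..<pi})"
    and int: "integrable (lebesgue_on {0<..<pi}) ?e"
    using assms by (auto simp: hspace_def)
  have e: "?e integrable_on {0<..<pi}"
    by (rule integrable_on_lebesgue_on[OF int]) auto
  have e0: "0 \<le> ?e t" for t using rho_pos[of t] by simp
  show "?e absolutely_integrable_on {0..pi}"
    unfolding absolutely_integrable_on_Icc_iff_Ioo
    using e0 e by (intro nonnegative_absolutely_integrable_1) auto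
  show "z absolutely_integrable_on {0..pi}"
    unfolding absolutely_integrable_on_Icc_iff_Ioo
  proof (rule measurable_bounded_by_integrable_imp_absolutely_integrable[OF zm])
    have "(\<lambda>x. 1 :: real) integrable_on {0<..<pi}"
      by (simp add: integrable_on_open_interval_real integrable_const_ivl)
    then show "(\<lambda>t. 1 + ?e t / min 1 \<alpha>) integrable_on {0<..<pi}"
      using e by (intro Henstock_Kurzweil_Integration.integrable_add integrable_on_divide)
    fix t
    have "2 * norm (z t) \<le> 1 + (norm (z t))\<^sup>2"
      using mult_sum_of_squares_le[of 1 1 "norm (z t)"] by simp
    then have "norm (z t) \<le> 1 + (norm (z t))\<^sup>2"
      using norm_ge_zero[of "z t"] by linarith
    also have "(norm (z t))\<^sup>2 * min 1 \<alpha> \<le> ?e t"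
      using rho_ge by (intro mult_left_mono) auto
    then have "(norm (z t))\<^sup>2 \<le> ?e t / min 1 \<alpha>"
      using \<alpha> by (subst pos_le_divide_eq) auto
    finally show "norm (z t) \<le> 1 + ?e t / min 1 \<alpha>" by simp
  qed auto
qed

lemma continuous_in_hspace:
  assumes "continuous_on {0..pi} y"
  shows "(y, y3, y4) \<in> hspace a \<alpha>"
proof -
  have "(\<lambda>t. (norm (y t))\<^sup>2 * rho a \<alpha> t) absolutely_integrable_on {0..pi}"
    by (intro absolutely_integrable_continuous_mult rho_integrable continuous_intros assms)
  then have "integrable (lebesgue_on {0<..<pi}) (\<lambda>t. (norm (y t))\<^sup>2 * rho a \<alpha> t)"
    unfolding absolutely_integrable_on_Icc_iff_Ioo by (rule absolutely_integrable_imp_integrable) auto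
  moreover have "y \<in> borel_measurable (lebesgue_on {0<..<pi})"
    by (rule continuous_imp_measurable_on_sets_lebesgue)
      (auto intro: continuous_on_subset[OF assms])
  ultimately show ?thesis by (simp add: hspace_def)
qed

lemma hspace_inner_eq:
  assumes "(\<lambda>t. \<rho> t * cdot (y t) (z t)) absolutely_integrable_on {0..pi}"
  shows "hspace_inner a \<alpha> k1 k2 (y, y3, y4) (z, z3, z4)
    = integral {0..pi} (\<lambda>t. \<rho> t * cdot (y t) (z t)) + y3 * cnj z3 / k1 + y4 * cnj z4 / k2"
proof -
  have "(\<lambda>t. (y t $ 1 * cnj (z t $ 1) + y t $ 2 * cnj (z t $ 2)) * \<rho> t) = (\<lambda>t. \<rho> t * cdot (y t) (z t))"
    by (rule ext) (simp only: cdot_def mult.commute)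
  then show ?thesis
    unfolding hspace_inner.simps by (simp only: LINT_Ioo_eq_integral[OF assms]) simp
qed

end

section \<open>The boundary value problem as a self-adjoint operator\<close>

locale dirac_bvp = dirac_system a \<alpha> p q
  for a \<alpha> :: real and p q :: "real \<Rightarrow> real" +
  fixes b1 b2 b3 b4 c1 c2 c3 c4 k1 k2 :: real
  assumes k1: "k1 = b1 * b4 - b2 * b3" "0 < k1"
    and k2: "k2 = c1 * c4 - c2 * c3" "0 < k2"

context dirac_bvp
begin

abbreviation form :: "helem \<Rightarrow> helem \<Rightarrow> complex" where
  "form \<equiv> hspace_inner a \<alpha> k1 k2"

abbreviation emb :: "(real \<Rightarrow> complex^2) \<Rightarrow> helem" where
  "emb \<equiv> to_hspace b3 b4 c3 c4"

fun energy :: "helem \<Rightarrow> real" where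
  "energy (y, y3, y4) = integral {0..pi} (\<lambda>t. (norm (y t))\<^sup>2 * rho a \<alpha> t)
     + (cmod y3)\<^sup>2 / k1 + (cmod y4)\<^sup>2 / k2"

text \<open>Says that \<open>y\<close> represents a solution \<open>Y\<close> of \<open>(L - \<mu>) Y = Z\<close>: the system with inhomogeneity \<open>\<rho> z\<close> and the two
  boundary conditions with right-hand sides \<open>z3\<close> and \<open>- z4\<close>.\<close>

fun resolvent_eq :: "complex \<Rightarrow> helem \<Rightarrow> (real \<Rightarrow> complex^2) \<Rightarrow> bool" where
  "resolvent_eq \<mu> (z, z3, z4) y \<longleftrightarrow> solves \<mu> z y \<and> U1 b1 b2 b3 b4 \<mu> y = z3 \<and> U2 c1 c2 c3 c4 \<mu> y = - z4"

lemma form_eq_left: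
  assumes "z absolutely_integrable_on {0..pi}" "continuous_on {0..pi} v"
  shows "form (z, z3, z4) (v, v3, v4)
    = integral {0..pi} (\<lambda>t. \<rho> t * cdot (z t) (v t)) + z3 * cnj v3 / k1 + z4 * cnj v4 / k2"
  by (rule hspace_inner_eq[OF weighted_cdot_integrable(1)[OF assms]])

lemma form_eq_right:
  assumes "z absolutely_integrable_on {0..pi}" "continuous_on {0..pi} v"
  shows "form (v, v3, v4) (z, z3, z4)
    = integral {0..pi} (\<lambda>t. \<rho> t * cdot (v t) (z t)) + v3 * cnj z3 / k1 + v4 * cnj z4 / k2"
  by (rule hspace_inner_eq[OF weighted_cdot_integrable(2)[OF assms]])

lemma form_commute:
  assumes "z absolutely_integrable_on {0..pi}" "continuous_on {0..pi} v"
  shows "form (v, v3, v4) (z, z3, z4) = cnj (form (z, z3, z4) (v, v3, v4))"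
  unfolding form_eq_left[OF assms] form_eq_right[OF assms]
  by (simp add: integral_cnj cnj_cdot mult.commute)

lemma form_self:
  assumes "continuous_on {0..pi} v"
  shows "form (v, v3, v4) (v, v3, v4) = complex_of_real (energy (v, v3, v4))"
proof -
  have "(\<lambda>t. (norm (v t))\<^sup>2 * rho a \<alpha> t) integrable_on {0..pi}"
    using hspace_integrable(2)[OF continuous_in_hspace[OF assms]] by (rule integrable_on_of_abs)
  from integral_linear[OF this bounded_linear_of_real]
  have "integral {0..pi} (\<lambda>t. \<rho> t * cdot (v t) (v t))
      = complex_of_real (integral {0..pi} (\<lambda>t. (norm (v t))\<^sup>2 * rho a \<alpha> t))"
    by (simp add: o_def cdot_self mult.commute)
  then show ?thesis
    unfolding form_eq_left[OF absolutely_integrable_continuous_real[OF assms] assms] energy.simps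
    by (simp only: of_real_add of_real_divide complex_norm_square)
qed

lemma form_add_scale_left:
  assumes y: "continuous_on {0..pi} y" and w: "continuous_on {0..pi} w" and v: "continuous_on {0..pi} v"
  shows "form (emb (\<lambda>t. y t + c *s w t)) (emb v) = form (emb y) (emb v) + c * form (emb w) (emb v)"
proof -
  have int: "(\<lambda>t. \<rho> t * cdot (u t) (v t)) integrable_on {0..pi}" if "continuous_on {0..pi} u" for u
    by (intro integrable_on_of_abs weighted_cdot_integrable absolutely_integrable_continuous_real that v)
  have cyw: "continuous_on {0..pi} (\<lambda>t. y t + c *s w t)"
    by (intro continuous_intros continuous_on_vector_scalar_mult y w)
  have "integral {0..pi} (\<lambda>t. \<rho> t * cdot (y t + c *s w t) (v t))
      = integral {0..pi} (\<lambda>t. \<rho> t * cdot (y t) (v t) + c * (\<rho> t * cdot (w t) (v t)))"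
    by (simp only: cdot_add_scale_left distrib_left mult.left_commute)
  also have "\<dots> = integral {0..pi} (\<lambda>t. \<rho> t * cdot (y t) (v t)) + c * integral {0..pi} (\<lambda>t. \<rho> t * cdot (w t) (v t))"
    unfolding Henstock_Kurzweil_Integration.integral_add[OF int[OF y] integrable_on_mult_right[OF int[OF w]]]
      integral_mult_right ..
  finally show ?thesis
    unfolding to_hspace_def form_eq_left[OF absolutely_integrable_continuous_real[OF y] v]
      form_eq_left[OF absolutely_integrable_continuous_real[OF w] v]
      form_eq_left[OF absolutely_integrable_continuous_real[OF cyw] v]
    by (simp add: algebra_simps add_divide_distrib)
qed

lemma energy_nonneg: "0 \<le> energy Y"
  and energy_ge_bulk: "integral {0..pi} (\<lambda>t. (norm (fst Y t))\<^sup>2 * rho a \<alpha> t) \<le> energy Y"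
  and energy_ge_left: "(cmod (fst (snd Y)))\<^sup>2 / k1 \<le> energy Y"
proof -
  obtain y y3 y4 where Y: "Y = (y, y3, y4)" by (metis prod_cases3)
  have "0 \<le> integral {0..pi} (\<lambda>t. (norm (y t))\<^sup>2 * rho a \<alpha> t)"
  proof (cases "(\<lambda>t. (norm (y t))\<^sup>2 * rho a \<alpha> t) integrable_on {0..pi}")
    case True
    then show ?thesis
      using less_imp_le[OF rho_pos] by (intro Henstock_Kurzweil_Integration.integral_nonneg) auto
  qed (simp add: not_integrable_integral)
  moreover have "0 \<le> (cmod y3)\<^sup>2 / k1" "0 \<le> (cmod y4)\<^sup>2 / k2"
    using k1(2) k2(2) by auto
  ultimately show "0 \<le> energy Y" "integral {0..pi} (\<lambda>t. (norm (fst Y t))\<^sup>2 * rho a \<alpha> t) \<le> energy Y"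
    "(cmod (fst (snd Y)))\<^sup>2 / k1 \<le> energy Y"
    by (auto simp: Y)
qed

text \<open>A Cauchy-Schwarz estimate in the weighted form \<open>\<bar>\<langle>Z, V\<rangle>\<bar> \<le> (\<parallel>Z\<parallel>\<^sup>2 / e + e \<parallel>V\<parallel>\<^sup>2) / 2\<close>.\<close>

lemma form_bound:
  assumes Z: "(z, z3, z4) \<in> hspace a \<alpha>" and v: "continuous_on {0..pi} v" and e: "0 < e"
  shows "cmod (form (z, z3, z4) (v, v3, v4)) \<le> (energy (z, z3, z4) / e + e * energy (v, v3, v4)) / 2"
proof -
  let ?P = "\<lambda>t. (norm (z t))\<^sup>2 * rho a \<alpha> t" and ?Q = "\<lambda>t. (norm (v t))\<^sup>2 * rho a \<alpha> t"
  have int: "?P integrable_on {0..pi}" "?Q integrable_on {0..pi}"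
    using hspace_integrable(2)[OF Z] hspace_integrable(2)[OF continuous_in_hspace[OF v]]
    by (auto intro: integrable_on_of_abs)
  have "cmod (integral {0..pi} (\<lambda>t. \<rho> t * cdot (z t) (v t))) \<le> integral {0..pi} (\<lambda>t. ?P t * (1 / (2 * e)) + ?Q t * (e / 2))"
  proof (rule integral_norm_bound_integral)
    show "(\<lambda>t. \<rho> t * cdot (z t) (v t)) integrable_on {0..pi}"
      by (intro integrable_on_of_abs weighted_cdot_integrable hspace_integrable(1)[OF Z] v)
    show "(\<lambda>t. ?P t * (1 / (2 * e)) + ?Q t * (e / 2)) integrable_on {0..pi}"
      by (intro Henstock_Kurzweil_Integration.integrable_add integrable_on_mult_left int)
    fix t
    have "cmod (\<rho> t * cdot (z t) (v t)) = rho a \<alpha> t * cmod (cdot (z t) (v t))"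
      using rho_pos[of t] by (simp add: norm_mult)
    also have "\<dots> \<le> rho a \<alpha> t * (((norm (z t))\<^sup>2 / e + e * (norm (v t))\<^sup>2) / 2)"
      using rho_pos[of t] cdot_sum_of_squares_le[OF e] by (intro mult_left_mono) auto
    also have "\<dots> = ?P t * (1 / (2 * e)) + ?Q t * (e / 2)"
      using e by (simp add: field_simps)
    finally show "cmod (\<rho> t * cdot (z t) (v t)) \<le> ?P t * (1 / (2 * e)) + ?Q t * (e / 2)" .
  qed
  also have "\<dots> = integral {0..pi} ?P * (1 / (2 * e)) + integral {0..pi} ?Q * (e / 2)"
    unfolding Henstock_Kurzweil_Integration.integral_add[OF integrable_on_mult_left[OF int(1)] integrable_on_mult_left[OF int(2)]]
      integral_mult_left ..
  finally have bulk: "cmod (integral {0..pi} (\<lambda>t. \<rho> t * cdot (z t) (v t)))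
      \<le> (integral {0..pi} ?P / e + e * integral {0..pi} ?Q) / 2"
    using e by (simp add: add_divide_distrib mult.commute)
  have boundary: "cmod (x * cnj y / complex_of_real k) \<le> ((cmod x)\<^sup>2 / k / e + e * ((cmod y)\<^sup>2 / k)) / 2" if "0 < k" for x y k
  proof -
    have "cmod x * cmod y / k \<le> ((cmod x)\<^sup>2 / e + e * (cmod y)\<^sup>2) / 2 / k"
      using mult_sum_of_squares_le[OF e] that by (intro divide_right_mono) auto
    also have "\<dots> = ((cmod x)\<^sup>2 / k / e + e * ((cmod y)\<^sup>2 / k)) / 2"
      by (simp add: add_divide_distrib mult_ac)
    finally show ?thesis
      using that by (simp add: norm_mult norm_divide)
  qed
  have "cmod (form (z, z3, z4) (v, v3, v4)) \<le> cmod (integral {0..pi} (\<lambda>t. \<rho> t * cdot (z t) (v t)))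
      + cmod (z3 * cnj v3 / k1) + cmod (z4 * cnj v4 / k2)"
    unfolding form_eq_left[OF hspace_integrable(1)[OF Z] v]
    by (intro norm_triangle_le add_mono) auto
  also have "\<dots> \<le> (integral {0..pi} ?P / e + e * integral {0..pi} ?Q) / 2
      + ((cmod z3)\<^sup>2 / k1 / e + e * ((cmod v3)\<^sup>2 / k1)) / 2 + ((cmod z4)\<^sup>2 / k2 / e + e * ((cmod v4)\<^sup>2 / k2)) / 2"
    by (intro add_mono bulk boundary k1 k2)
  also have "\<dots> = (energy (z, z3, z4) / e + e * energy (v, v3, v4)) / 2"
    unfolding energy.simps add_divide_distrib distrib_left by linarith
  finally show ?thesis .
qed

text \<open>The inequality \<open>\<bar>y\<bar> \<le> (1 / e + e \<bar>y\<bar>\<^sup>2) / 2\<close> integrated.  For \<open>e = \<bar>Im \<mu>\<bar>\<close> and energy of order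
  \<open>1 / \<bar>Im \<mu>\<bar>\<^sup>2\<close> the right-hand side is of order \<open>1 / \<bar>Im \<mu>\<bar>\<close>.\<close>

lemma indefinite_integral_energy_bound:
  assumes y: "continuous_on {0..pi} y" and x: "x \<in> {0..pi}" and e: "0 < e"
  shows "cmod (integral {0..x} (\<lambda>t. y t $ i)) \<le> (pi / e + e * (energy (emb y) / min 1 \<alpha>)) / 2"
proof -
  let ?Q = "\<lambda>t. (norm (y t))\<^sup>2 * rho a \<alpha> t"
  have Q: "?Q integrable_on {0..pi}"
    using hspace_integrable(2)[OF continuous_in_hspace[OF y]] by (rule integrable_on_of_abs)
  have Gpi: "(\<lambda>t. 1 / (2 * e) + ?Q t * (e / (2 * min 1 \<alpha>))) integrable_on {0..pi}"
    by (intro Henstock_Kurzweil_Integration.integrable_add integrable_on_mult_left Q integrable_const_ivl)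
  have Gx: "(\<lambda>t. 1 / (2 * e) + ?Q t * (e / (2 * min 1 \<alpha>))) integrable_on {0..x}"
    by (rule integrable_on_subinterval[OF Gpi]) (use x in auto)
  have "cmod (integral {0..x} (\<lambda>t. y t $ i)) \<le> integral {0..x} (\<lambda>t. 1 / (2 * e) + ?Q t * (e / (2 * min 1 \<alpha>)))"
  proof (rule integral_norm_bound_integral[OF _ Gx])
    show "(\<lambda>t. y t $ i) integrable_on {0..x}"
      using x by (intro integrable_continuous_real continuous_intros continuous_on_subset[OF y]) auto
    fix t
    have m: "min 1 \<alpha> > 0" using \<alpha> by simp
    have "cmod (y t $ i) \<le> norm (y t)"
      by (rule Finite_Cartesian_Product.norm_nth_le)
    also have "norm (y t) \<le> (1 / e + e * (norm (y t))\<^sup>2) / 2"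
      using mult_sum_of_squares_le[OF e, of 1 "norm (y t)"] by simp
    also have "(norm (y t))\<^sup>2 \<le> ?Q t / min 1 \<alpha>"
      using mult_left_mono[OF rho_ge[of t], of "(norm (y t))\<^sup>2"] m by (simp add: pos_le_divide_eq)
    then have "(1 / e + e * (norm (y t))\<^sup>2) / 2 \<le> (1 / e + e * (?Q t / min 1 \<alpha>)) / 2"
      using e by (intro divide_right_mono add_left_mono mult_left_mono) auto
    also have "\<dots> = 1 / (2 * e) + ?Q t * (e / (2 * min 1 \<alpha>))"
      by (simp add: add_divide_distrib mult_ac)
    finally show "cmod (y t $ i) \<le> 1 / (2 * e) + ?Q t * (e / (2 * min 1 \<alpha>))" .
  qed
  also have "\<dots> \<le> integral {0..pi} (\<lambda>t. 1 / (2 * e) + ?Q t * (e / (2 * min 1 \<alpha>)))"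
    using x e \<alpha> less_imp_le[OF rho_pos]
    by (intro integral_subset_le[OF _ Gx Gpi]) auto
  also have "\<dots> = pi / (2 * e) + integral {0..pi} ?Q * (e / (2 * min 1 \<alpha>))"
    unfolding Henstock_Kurzweil_Integration.integral_add[OF integrable_const_ivl integrable_on_mult_left[OF Q]]
      integral_mult_left by simp
  also have "\<dots> \<le> pi / (2 * e) + energy (emb y) * (e / (2 * min 1 \<alpha>))"
    using energy_ge_bulk[of "emb y"] e \<alpha> by (intro add_left_mono mult_right_mono) (auto simp: to_hspace_def)
  also have "\<dots> = (pi / e + e * (energy (emb y) / min 1 \<alpha>)) / 2"
    by (simp add: add_divide_distrib mult_ac)
  finally show ?thesis .
qed

text \<open>Symmetry of \<open>L\<close>, stated for \<open>Z = (L - \<kappa>) Y\<close> and \<open>X = (L - \<mu>) V\<close>.  The boundary conditions convert the third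
  and fourth components into \<open>k1\<close> and \<open>- k2\<close> times the boundary terms of the Lagrange identity at \<open>0\<close>
  and \<open>\<pi>\<close>; the weights of the inner product remove these factors and everything cancels.\<close>

lemma green_identity:
  assumes y: "resolvent_eq \<kappa> (z, z3, z4) y" and v: "resolvent_eq \<mu> (x, x3, x4) v"
    and z: "z absolutely_integrable_on {0..pi}" and x: "x absolutely_integrable_on {0..pi}"
  shows "form (z, z3, z4) (emb v) - form (emb y) (x, x3, x4) = (cnj \<mu> - \<kappa>) * form (emb y) (emb v)"
proof -
  have cy: "continuous_on {0..pi} y" and cv: "continuous_on {0..pi} v"
    using y v by (auto simp: solves_def)
  define I where "I = integral {0..pi} (\<lambda>t. \<rho> t * cdot (y t) (v t))"
  define Iz where "Iz = integral {0..pi} (\<lambda>t. \<rho> t * cdot (z t) (v t))"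
  define Ix where "Ix = integral {0..pi} (\<lambda>t. \<rho> t * cdot (y t) (x t))"
  define W where "W s = y s $ 2 * cnj (v s $ 1) - y s $ 1 * cnj (v s $ 2)" for s
  have green: "W pi - W 0 = (\<kappa> - cnj \<mu>) * I + Iz - Ix"
    unfolding W_def I_def Iz_def Ix_def
    by (rule green_formula) (use y v z x in auto)
  define y3 y4 v3 v4 where "y3 = b3 * y 0 $ 2 + b4 * y 0 $ 1" and "y4 = c3 * y pi $ 2 + c4 * y pi $ 1"
    and "v3 = b3 * v 0 $ 2 + b4 * v 0 $ 1" and "v4 = c3 * v pi $ 2 + c4 * v pi $ 1"
  have left: "z3 * cnj v3 - y3 * cnj x3 = (cnj \<mu> - \<kappa>) * (y3 * cnj v3) + k1 * W 0"
  proof -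
    have zz: "z3 = b1 * y 0 $ 2 + b2 * y 0 $ 1 - \<kappa> * y3" "x3 = b1 * v 0 $ 2 + b2 * v 0 $ 1 - \<mu> * v3"
      using y v by (auto simp: U1_def y3_def v3_def)
    show ?thesis
      unfolding zz by (simp add: y3_def v3_def W_def k1(1) algebra_simps)
  qed
  have right: "z4 * cnj v4 - y4 * cnj x4 = (cnj \<mu> - \<kappa>) * (y4 * cnj v4) - k2 * W pi"
  proof -
    have "- z4 = c1 * y pi $ 2 + c2 * y pi $ 1 + \<kappa> * y4" "- x4 = c1 * v pi $ 2 + c2 * v pi $ 1 + \<mu> * v4"
      using y v by (auto simp: U2_def y4_def v4_def)
    then have zz: "z4 = - (c1 * y pi $ 2 + c2 * y pi $ 1 + \<kappa> * y4)" "x4 = - (c1 * v pi $ 2 + c2 * v pi $ 1 + \<mu> * v4)"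
      by (metis minus_minus)+
    show ?thesis
      unfolding zz by (simp add: y4_def v4_def W_def k2(1) algebra_simps)
  qed
  have "form (z, z3, z4) (emb v) - form (emb y) (x, x3, x4)
      = Iz - Ix + (z3 * cnj v3 - y3 * cnj x3) / k1 + (z4 * cnj v4 - y4 * cnj x4) / k2"
    unfolding to_hspace_def form_eq_left[OF z cv] form_eq_right[OF x cy] Iz_def Ix_def
      y3_def y4_def v3_def v4_def diff_divide_distrib by simp
  also have "\<dots> = (Iz - Ix + W 0 - W pi) + (cnj \<mu> - \<kappa>) * (y3 * cnj v3 / k1 + y4 * cnj v4 / k2)"
    unfolding left right using k1(2) k2(2) by (simp add: field_simps)
  also have "Iz - Ix + W 0 - W pi = (cnj \<mu> - \<kappa>) * I"
    using green by (simp add: algebra_simps)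
  also have "(cnj \<mu> - \<kappa>) * I + (cnj \<mu> - \<kappa>) * (y3 * cnj v3 / k1 + y4 * cnj v4 / k2)
      = (cnj \<mu> - \<kappa>) * form (emb y) (emb v)"
    unfolding to_hspace_def form_eq_left[OF absolutely_integrable_continuous_real[OF cy] cv] I_def
      y3_def y4_def v3_def v4_def by (simp add: distrib_left add.assoc)
  finally show ?thesis .
qed

text \<open>The case \<open>V = Y\<close>, \<open>X = Z\<close> of the Green identity reads \<open>Im \<langle>Z, Y\<rangle> = - Im \<mu> \<parallel>Y\<parallel>\<^sup>2\<close>, and \<open>\<langle>Z, Y\<rangle>\<close> is
  estimated by \<open>form_bound\<close> with \<open>e = \<bar>Im \<mu>\<bar>\<close>.\<close>

lemma resolvent_bound:
  assumes y: "resolvent_eq \<mu> (z, z3, z4) y" and Z: "(z, z3, z4) \<in> hspace a \<alpha>" and \<mu>: "Im \<mu> \<noteq> 0"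
  shows "(Im \<mu>)\<^sup>2 * energy (emb y) \<le> energy (z, z3, z4)"
proof -
  have cy: "continuous_on {0..pi} y" using y by (simp add: solves_def)
  have z: "z absolutely_integrable_on {0..pi}" by (rule hspace_integrable(1)[OF Z])
  define F where "F = form (z, z3, z4) (emb y)"
  have e: "\<bar>Im \<mu>\<bar> > 0" using \<mu> by simp
  have half: "A \<le> B" if "A \<le> (B + A) / 2" for A B :: real
    using that by simp
  have "F - cnj F = (cnj \<mu> - \<mu>) * energy (emb y)"
    using green_identity[OF y y z z]
    unfolding F_def to_hspace_def form_commute[OF z cy] form_self[OF cy] .
  then have "Im F = - Im \<mu> * energy (emb y)"
    by (simp add: complex_eq_iff)
  then have "\<bar>Im \<mu>\<bar> * energy (emb y) = \<bar>Im F\<bar>"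
    using energy_nonneg[of "emb y"] by (simp add: abs_mult)
  also have "\<dots> \<le> (energy (z, z3, z4) / \<bar>Im \<mu>\<bar> + \<bar>Im \<mu>\<bar> * energy (emb y)) / 2"
    unfolding F_def to_hspace_def by (rule order_trans[OF abs_Im_le_cmod form_bound[OF Z cy e]])
  finally have "\<bar>Im \<mu>\<bar> * energy (emb y) \<le> energy (z, z3, z4) / \<bar>Im \<mu>\<bar>"
    by (rule half)
  then have "\<bar>Im \<mu>\<bar> * energy (emb y) * \<bar>Im \<mu>\<bar> \<le> energy (z, z3, z4)"
    using e by (simp only: pos_le_divide_eq)
  moreover have "(Im \<mu>)\<^sup>2 = \<bar>Im \<mu>\<bar> * \<bar>Im \<mu>\<bar>"
    by (simp add: power2_eq_square)
  ultimately show ?thesis by (simp only: mult_ac)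
qed

lemma holomorphic_form:
  fixes y :: "complex \<Rightarrow> real \<Rightarrow> complex^2"
  assumes cy: "\<And>\<mu>. continuous_on {0..pi} (y \<mu>)" and F: "continuous_on {0..pi} F"
    and eq: "\<And>\<mu> x. x \<in> {0..pi} \<Longrightarrow>
               y \<mu> x = u0 + \<mu> *s u1 + F x + integral {0..x} (\<lambda>t. dirac \<mu> t (y \<mu> t))"
    and v: "continuous_on {0..pi} v"
  shows "(\<lambda>\<mu>. form (emb (y \<mu>)) (emb v)) holomorphic_on UNIV"
proof -
  let ?g = "\<lambda>i t. \<rho> t * cnj (v t $ i)"
  have g: "?g i absolutely_integrable_on {0..pi}" for i
    by (intro rho_mult_integrable absolutely_integrable_continuous_real continuous_intros v)
  have int: "(\<lambda>t. ?g i t * y \<mu> t $ i) integrable_on {0..pi}" for i \<mu>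
    by (intro integrable_on_of_abs absolutely_integrable_mult_continuous g continuous_intros cy)
  have hol_eval: "(\<lambda>\<mu>. y \<mu> x $ i) holomorphic_on UNIV" if "x \<in> {0..pi}" for x i
    by (rule holomorphic_eval[OF cy F eq that])
  have "(\<lambda>\<mu>. integral {0..pi} (\<lambda>t. ?g 1 t * y \<mu> t $ 1) + integral {0..pi} (\<lambda>t. ?g 2 t * y \<mu> t $ 2)
      + (b3 * y \<mu> 0 $ 2 + b4 * y \<mu> 0 $ 1) * cnj (b3 * v 0 $ 2 + b4 * v 0 $ 1) / k1
      + (c3 * y \<mu> pi $ 2 + c4 * y \<mu> pi $ 1) * cnj (c3 * v pi $ 2 + c4 * v pi $ 1) / k2) holomorphic_on UNIV"
    using k1(2) k2(2) by (intro holomorphic_intros holomorphic_integral[OF cy F eq g] hol_eval) auto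
  moreover have "integral {0..pi} (\<lambda>t. \<rho> t * cdot (y \<mu> t) (v t))
      = integral {0..pi} (\<lambda>t. ?g 1 t * y \<mu> t $ 1) + integral {0..pi} (\<lambda>t. ?g 2 t * y \<mu> t $ 2)" for \<mu>
    unfolding Henstock_Kurzweil_Integration.integral_add[OF int int, symmetric]
    by (rule arg_cong[where f = "integral {0..pi}"]) (simp add: fun_eq_iff cdot_def algebra_simps)
  ultimately show ?thesis
    unfolding to_hspace_def form_eq_left[OF absolutely_integrable_continuous_real[OF cy] v] by simp
qed

end

section \<open>Completeness of the eigenfunctions\<close>

context dirac_bvp
begin

declare hspace_inner.simps [simp del]

text \<open>In the proof \<open>f\<close> is the solution called \<open>\<phi>\<close> above, \<open>D\<close> is the characteristic function whose zeros are the
  eigenvalues, and the resolvent applied to \<open>(z, z3, z4)\<close> is \<open>w \<mu> + C \<mu> f \<mu>\<close> with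
  \<open>C = Q / D\<close> away from the eigenvalues.\<close>

lemma orthogonal_to_eigenfunctions_imp_zero:
  fixes f :: "complex \<Rightarrow> real \<Rightarrow> complex^2"
  assumes f: "\<And>\<mu>. is_solution a \<alpha> p q \<mu> (f \<mu>)"
    and f0: "\<And>\<mu>. f \<mu> 0 = vector [\<mu> * complex_of_real b3 - complex_of_real b1,
                            complex_of_real b2 - \<mu> * complex_of_real b4]"
    and Z: "(z, z3, z4) \<in> hspace a \<alpha>"
    and orth: "\<And>\<mu>. U2 c1 c2 c3 c4 \<mu> (f \<mu>) = 0 \<Longrightarrow> form (z, z3, z4) (emb (f \<mu>)) = 0"
  shows "hspace_zero (z, z3, z4)"
proof -
  have z: "z absolutely_integrable_on {0..pi}"
    by (rule hspace_integrable(1)[OF Z])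
  have sol_f: "solves \<mu> (\<lambda>_. 0) (f \<mu>)" for \<mu>
    using is_solution_imp_integral_equation[OF f] unfolding solves_def rhoJ_0 add_0_right by blast
  have cf: "continuous_on {0..pi} (f \<mu>)" for \<mu>
    by (rule is_solution_imp_integral_equation(1)[OF f])
  define f_const f_slope :: "complex^2"
    where "f_const = vector [- complex_of_real b1, complex_of_real b2]"
      and "f_slope = vector [complex_of_real b3, - complex_of_real b4]"
  have eq_f: "f \<mu> x = f_const + \<mu> *s f_slope + 0 + integral {0..x} (\<lambda>t. dirac \<mu> t (f \<mu> t))"
    if "x \<in> {0..pi}" for \<mu> x
  proof -
    have "f \<mu> 0 = f_const + \<mu> *s f_slope"
      by (simp add: f0 f_const_def f_slope_def complex2_eq_iff)
    then show ?thesis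
      using is_solution_imp_integral_equation(2)[OF f that, of \<mu>] by simp
  qed
  \<comment> \<open>This initial value solves \<open>b1 u\<^sub>2 + b2 u\<^sub>1 = z3\<close> and \<open>b3 u\<^sub>2 + b4 u\<^sub>1 = 0\<close>; the determinant is \<open>k1\<close>.\<close>
  define u :: "complex^2" where "u = vector [- (b3 * z3 / k1), b4 * z3 / k1]"
  define F where "F x = integral {0..x} (\<lambda>t. rhoJ t (z t))" for x
  have cF: "continuous_on {0..pi} F"
    unfolding F_def by (intro continuous_on_indefinite_integral rhoJ_integrable_L1 z)
  have "\<exists>y. continuous_on {0..pi} y \<and>
      (\<forall>x\<in>{0..pi}. y x = u + \<mu> *s 0 + F x + integral {0..x} (\<lambda>t. dirac \<mu> t (y t)))" for \<mu>
  proof -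
    interpret volterra 0 pi "dirac \<mu>" "dirac_bound (cmod \<mu>)"
      by (rule dirac_volterra) simp
    have "continuous_on {0..pi} (\<lambda>x. u + \<mu> *s 0 + F x)"
      by (intro continuous_intros cF)
    then show ?thesis by (rule solution_exists) blast
  qed
  then obtain w where cw: "\<And>\<mu>. continuous_on {0..pi} (w \<mu>)"
    and eq_w: "\<And>\<mu> x. x \<in> {0..pi} \<Longrightarrow>
        w \<mu> x = u + \<mu> *s 0 + F x + integral {0..x} (\<lambda>t. dirac \<mu> t (w \<mu> t))"
    by metis
  have w0: "w \<mu> 0 = u" for \<mu>
    using eq_w[of 0 \<mu>] by (simp add: F_def)
  have sol_w: "solves \<mu> z (w \<mu>)" for \<mu>
  proof -
    have "w \<mu> x = w \<mu> 0 + integral {0..x} (\<lambda>t. dirac \<mu> t (w \<mu> t) + rhoJ t (z t))" if x: "x \<in> {0..pi}" for x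
    proof -
      have sub: "g integrable_on {0..x}" if "g absolutely_integrable_on {0..pi}" for g :: "real \<Rightarrow> complex^2"
        using absolutely_integrable_on_Icc_subset[OF that, of 0 x] x by (auto intro: integrable_on_of_abs)
      show ?thesis
        unfolding w0 Henstock_Kurzweil_Integration.integral_add[OF sub[OF dirac_integrable[OF cw]] sub[OF rhoJ_integrable_L1[OF z]]]
        using eq_w[OF x, of \<mu>] by (simp add: F_def)
    qed
    then show ?thesis unfolding solves_def using cw by blast
  qed
  have U1_f: "U1 b1 b2 b3 b4 \<mu> (f \<mu>) = 0" for \<mu>
    by (simp add: U1_def f0 algebra_simps)
  have k1_det: "complex_of_real b1 * b4 - b2 * b3 = k1"
    by (simp add: k1(1))
  have k1_nz: "complex_of_real k1 \<noteq> 0"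
    using k1(2) by simp
  have left_f: "b3 * f \<mu> 0 $ 2 + b4 * f \<mu> 0 $ 1 = - k1" for \<mu>
    using k1_det by (simp add: f0 algebra_simps)
  have left_w: "b3 * w \<mu> 0 $ 2 + b4 * w \<mu> 0 $ 1 = 0" for \<mu>
    by (simp add: w0 u_def)
  have U1_w: "U1 b1 b2 b3 b4 \<mu> (w \<mu>) = z3" for \<mu>
  proof -
    have "b1 * w \<mu> 0 $ 2 + b2 * w \<mu> 0 $ 1 = (b1 * b4 - b2 * b3) * z3 / k1"
      by (simp add: w0 u_def diff_divide_distrib left_diff_distrib mult.assoc)
    then show ?thesis
      unfolding U1_def left_w using k1_det k1_nz by simp
  qed
  define D where "D \<mu> = U2 c1 c2 c3 c4 \<mu> (f \<mu>)" for \<mu>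
  define Q where "Q \<mu> = - (z4 + U2 c1 c2 c3 c4 \<mu> (w \<mu>))" for \<mu>
  have resolvent: "resolvent_eq \<mu> (z, z3, z4) (\<lambda>t. w \<mu> t + c *s f \<mu> t)" if "c * D \<mu> = Q \<mu>" for \<mu> c
  proof -
    have "U1 b1 b2 b3 b4 \<mu> (\<lambda>t. w \<mu> t + c *s f \<mu> t) = U1 b1 b2 b3 b4 \<mu> (w \<mu>) + c * U1 b1 b2 b3 b4 \<mu> (f \<mu>)"
      "U2 c1 c2 c3 c4 \<mu> (\<lambda>t. w \<mu> t + c *s f \<mu> t) = U2 c1 c2 c3 c4 \<mu> (w \<mu>) + c * D \<mu>"
      by (simp_all add: U1_def U2_def D_def algebra_simps)
    then show ?thesis
      using that solves_add_scale[OF sol_w sol_f z] by (simp add: U1_w U1_f Q_def)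
  qed
  have eigen: "resolvent_eq \<mu> (\<lambda>_. 0, 0, 0) (f \<mu>)" if "D \<mu> = 0" for \<mu>
    using that sol_f U1_f by (simp add: D_def)
  have zero_mem: "((\<lambda>_. 0) :: real \<Rightarrow> complex^2, 0, 0) \<in> hspace a \<alpha>"
    by (rule continuous_in_hspace) simp
  have energy_f: "0 < energy (emb (f \<mu>))" for \<mu>
    using energy_ge_left[of "emb (f \<mu>)"] k1(2) left_f[of \<mu>] by (simp add: to_hspace_def power2_eq_square)
  \<comment> \<open>An eigenvalue off the real axis would have an eigenfunction of zero norm.\<close>
  have D_real: "Im \<mu> = 0" if "D \<mu> = 0" for \<mu>
  proof (rule ccontr)
    assume "Im \<mu> \<noteq> 0"
    with resolvent_bound[OF eigen[OF that] zero_mem] have "(Im \<mu>)\<^sup>2 * energy (emb (f \<mu>)) \<le> 0"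
      by simp
    then show False
      using energy_f[of \<mu>] \<open>Im \<mu> \<noteq> 0\<close> by (simp add: mult_le_0_iff)
  qed
  have pi_mem: "pi \<in> {0..pi}" by simp
  have hol_D: "D holomorphic_on UNIV"
    unfolding D_def[abs_def] U2_def
    by (intro holomorphic_intros holomorphic_eval[OF cf continuous_on_const eq_f pi_mem])
  have hol_Q: "Q holomorphic_on UNIV"
    unfolding Q_def[abs_def] U2_def
    by (intro holomorphic_intros holomorphic_eval[OF cw cF eq_w pi_mem])
  define A where "A \<kappa> \<mu> = form (emb (w \<mu>)) (emb (f \<kappa>))" for \<kappa> \<mu>
  define G where "G \<kappa> \<mu> = form (emb (f \<mu>)) (emb (f \<kappa>))" for \<kappa> \<mu>
  have hol_A: "A \<kappa> holomorphic_on UNIV" for \<kappa>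
    unfolding A_def[abs_def] by (rule holomorphic_form[OF cw cF eq_w cf])
  have hol_G: "G \<kappa> holomorphic_on UNIV" for \<kappa>
    unfolding G_def[abs_def] by (rule holomorphic_form[OF cf continuous_on_const eq_f cf])
  have G_nz: "G \<kappa> \<kappa> \<noteq> 0" for \<kappa>
    unfolding G_def to_hspace_def form_self[OF cf]
    using energy_f[of \<kappa>] by (simp add: to_hspace_def del: energy.simps)
  \<comment> \<open>Orthogonality of the resolvent to the eigenfunction \<open>f \<kappa>\<close>.\<close>
  have quotient: "Q \<mu> / D \<mu> * G \<kappa> \<mu> = - A \<kappa> \<mu>" if "D \<kappa> = 0" "D \<mu> \<noteq> 0" for \<kappa> \<mu>
  proof -
    have "\<kappa> \<noteq> \<mu>" using that by auto
    define c where "c = Q \<mu> / D \<mu>"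
    have "resolvent_eq \<mu> (z, z3, z4) (\<lambda>t. w \<mu> t + c *s f \<mu> t)"
      by (rule resolvent) (use that in \<open>simp add: c_def\<close>)
    from green_identity[OF this eigen[OF that(1)] z]
    have "(cnj \<kappa> - \<mu>) * form (emb (\<lambda>t. w \<mu> t + c *s f \<mu> t)) (emb (f \<kappa>))
        = form (z, z3, z4) (emb (f \<kappa>)) - form (emb (\<lambda>t. w \<mu> t + c *s f \<mu> t)) (\<lambda>_. 0, 0, 0)"
      by simp
    also have "form (z, z3, z4) (emb (f \<kappa>)) - form (emb (\<lambda>t. w \<mu> t + c *s f \<mu> t)) (\<lambda>_. 0, 0, 0) = 0"
      using orth that(1) by (simp add: D_def to_hspace_def hspace_inner.simps)
    finally have "(cnj \<kappa> - \<mu>) * form (emb (\<lambda>t. w \<mu> t + c *s f \<mu> t)) (emb (f \<kappa>)) = 0" .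
    moreover have "cnj \<kappa> = \<kappa>"
      using D_real[OF that(1)] by (simp add: complex_eq_iff)
    ultimately have "form (emb (\<lambda>t. w \<mu> t + c *s f \<mu> t)) (emb (f \<kappa>)) = 0"
      using \<open>\<kappa> \<noteq> \<mu>\<close> by simp
    then show ?thesis
      unfolding form_add_scale_left[OF cw cf cf] by (simp add: A_def G_def c_def add_eq_0_iff)
  qed
  \<comment> \<open>At an eigenvalue, \<open>C\<close> takes the value that \<open>quotient\<close> suggests for its limit.\<close>
  define C where "C \<mu> = (if D \<mu> \<noteq> 0 then Q \<mu> / D \<mu> else - A \<mu> \<mu> / G \<mu> \<mu>)" for \<mu>
  have C_diff: "C field_differentiable (at \<kappa>)" for \<kappa>
  proof (cases "D \<kappa> = 0")
    case False
    have "isCont D \<kappa>"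
      using holomorphic_on_imp_continuous_on[OF hol_D] by (simp add: continuous_on_eq_continuous_at)
    then obtain r where r: "0 < r" "\<And>\<mu>. dist \<mu> \<kappa> < r \<Longrightarrow> D \<mu> \<noteq> 0"
      using continuous_at_avoid[of \<kappa> D 0] False by (auto simp: dist_commute)
    show ?thesis
    proof (rule field_differentiable_transform_within[OF r(1)])
      show "(\<lambda>\<mu>. Q \<mu> / D \<mu>) field_differentiable (at \<kappa>)"
        using hol_Q hol_D False by (intro field_differentiable_divide) (auto simp: holomorphic_on_def)
    qed (use r in \<open>auto simp: C_def\<close>)
  next
    case True
    \<comment> \<open>\<open>D\<close> is not identically zero, so the eigenvalue \<open>\<kappa>\<close> is isolated.\<close>
    have "D \<i> \<noteq> 0" using D_real[of \<i>] by auto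
    then obtain r1 where r1: "0 < r1" "\<And>\<mu>. \<mu> \<in> ball \<kappa> r1 - {\<kappa>} \<Longrightarrow> D \<mu> \<noteq> 0"
      using isolated_zeros[OF hol_D open_UNIV connected_UNIV _ True, of \<i>] by auto
    have "isCont (G \<kappa>) \<kappa>"
      using holomorphic_on_imp_continuous_on[OF hol_G] by (simp add: continuous_on_eq_continuous_at)
    then obtain r2 where r2: "0 < r2" "\<And>\<mu>. dist \<mu> \<kappa> < r2 \<Longrightarrow> G \<kappa> \<mu> \<noteq> 0"
      using continuous_at_avoid[of \<kappa> "G \<kappa>" 0] G_nz by (auto simp: dist_commute)
    show ?thesis
    proof (rule field_differentiable_transform_within[of "min r1 r2"])
      show "(\<lambda>\<mu>. - A \<kappa> \<mu> / G \<kappa> \<mu>) field_differentiable (at \<kappa>)"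
        using hol_A[of \<kappa>] hol_G[of \<kappa>] G_nz
        by (intro field_differentiable_divide field_differentiable_minus) (auto simp: holomorphic_on_def)
      fix \<mu> assume \<mu>: "dist \<mu> \<kappa> < min r1 r2"
      show "- A \<kappa> \<mu> / G \<kappa> \<mu> = C \<mu>"
      proof (cases "\<mu> = \<kappa>")
        case False
        then have "D \<mu> \<noteq> 0" using r1(2)[of \<mu>] \<mu> by (auto simp: dist_commute)
        moreover have "G \<kappa> \<mu> \<noteq> 0" using r2(2)[of \<mu>] \<mu> by simp
        ultimately have "- A \<kappa> \<mu> / G \<kappa> \<mu> = Q \<mu> / D \<mu>"
          using quotient[OF True, of \<mu>] by (simp only: divide_eq_eq) simp
        then show ?thesis using \<open>D \<mu> \<noteq> 0\<close> by (simp add: C_def)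
      qed (use True in \<open>simp add: C_def\<close>)
    qed (use r1 r2 in auto)
  qed
  have hol_C: "C holomorphic_on UNIV"
    using C_diff by (simp add: holomorphic_on_def)
  let ?E = "energy (z, z3, z4)"
  \<comment> \<open>The third component of the resolvent is \<open>- k1 * C \<mu>\<close>.\<close>
  have C_bound: "cmod (C \<mu>) \<le> sqrt (?E / k1) / \<bar>Im \<mu>\<bar>" if \<mu>: "Im \<mu> \<noteq> 0" for \<mu>
  proof -
    have D: "D \<mu> \<noteq> 0" using D_real \<mu> by blast
    let ?y = "\<lambda>t. w \<mu> t + C \<mu> *s f \<mu> t"
    have left: "fst (snd (emb ?y)) = - k1 * C \<mu>"
    proof -
      have "fst (snd (emb ?y)) = (b3 * w \<mu> 0 $ 2 + b4 * w \<mu> 0 $ 1) + C \<mu> * (b3 * f \<mu> 0 $ 2 + b4 * f \<mu> 0 $ 1)"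
        by (simp add: to_hspace_def algebra_simps)
      then show ?thesis unfolding left_w left_f by simp
    qed
    have "(Im \<mu>)\<^sup>2 * energy (emb ?y) \<le> ?E"
      by (rule resolvent_bound[OF resolvent Z \<mu>]) (use D in \<open>simp add: C_def\<close>)
    moreover have "k1 * (cmod (C \<mu>))\<^sup>2 \<le> energy (emb ?y)"
      using energy_ge_left[of "emb ?y"] k1(2) unfolding left
      by (simp add: norm_mult power_mult_distrib power2_eq_square mult_ac)
    ultimately have "(Im \<mu>)\<^sup>2 * (k1 * (cmod (C \<mu>))\<^sup>2) \<le> ?E"
      by (meson mult_left_mono order_trans zero_le_power2)
    then have "(\<bar>Im \<mu>\<bar> * cmod (C \<mu>))\<^sup>2 \<le> ?E / k1"
      using k1(2) by (simp add: pos_le_divide_eq power_mult_distrib mult_ac)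
    then have "\<bar>Im \<mu>\<bar> * cmod (C \<mu>) \<le> sqrt (?E / k1)"
      by (rule real_le_rsqrt)
    then show ?thesis
      using \<mu> by (simp add: pos_le_divide_eq mult.commute)
  qed
  have C0: "C \<mu> = 0" for \<mu>
    by (rule entire_eq_0_of_imaginary_bound[OF hol_C C_bound])
  have w_resolvent: "resolvent_eq \<mu> (z, z3, z4) (w \<mu>)" if "Im \<mu> \<noteq> 0" for \<mu>
  proof -
    have D: "D \<mu> \<noteq> 0" using D_real that by blast
    then have "Q \<mu> = 0" using C0[of \<mu>] by (simp add: C_def)
    then show ?thesis using resolvent[of 0 \<mu>] by simp
  qed
  \<comment> \<open>Point values of \<open>w\<close> are not controlled by its energy, but its indefinite integrals are.\<close>
  have int_w: "integral {0..x} (\<lambda>t. w \<mu> t $ i) = 0" if x: "x \<in> {0..pi}" for x i \<mu>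
  proof (rule entire_eq_0_of_imaginary_bound[where f = "\<lambda>\<mu>. integral {0..x} (\<lambda>t. w \<mu> t $ i)"])
    have "(\<lambda>\<mu>. integral {0..x} (\<lambda>t. (\<lambda>_. 1) t * w \<mu> t $ i)) holomorphic_on UNIV"
      by (rule holomorphic_integral[OF cw cF eq_w _ x]) auto
    then show "(\<lambda>\<mu>. integral {0..x} (\<lambda>t. w \<mu> t $ i)) holomorphic_on UNIV"
      by simp
    fix \<mu> assume \<mu>: "Im \<mu> \<noteq> 0"
    have e: "0 < \<bar>Im \<mu>\<bar>" using \<mu> by simp
    have "\<bar>Im \<mu>\<bar> * energy (emb (w \<mu>)) \<le> ?E / \<bar>Im \<mu>\<bar>"
    proof -
      have sq: "(Im \<mu>)\<^sup>2 = \<bar>Im \<mu>\<bar> * \<bar>Im \<mu>\<bar>"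
        by (simp add: power2_eq_square)
      have "\<bar>Im \<mu>\<bar> * energy (emb (w \<mu>)) * \<bar>Im \<mu>\<bar> = (Im \<mu>)\<^sup>2 * energy (emb (w \<mu>))"
        unfolding sq by (simp only: mult_ac)
      then show ?thesis
        using resolvent_bound[OF w_resolvent[OF \<mu>] Z \<mu>] e by (simp only: pos_le_divide_eq)
    qed
    then have "\<bar>Im \<mu>\<bar> * energy (emb (w \<mu>)) / min 1 \<alpha> \<le> ?E / \<bar>Im \<mu>\<bar> / min 1 \<alpha>"
      using \<alpha> by (intro divide_right_mono) auto
    then have "(pi / \<bar>Im \<mu>\<bar> + \<bar>Im \<mu>\<bar> * (energy (emb (w \<mu>)) / min 1 \<alpha>)) / 2 \<le> (pi / \<bar>Im \<mu>\<bar> + ?E / \<bar>Im \<mu>\<bar> / min 1 \<alpha>) / 2"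
      by (intro divide_right_mono add_left_mono) (simp_all del: energy.simps)
    also have "\<dots> = ((pi + ?E / min 1 \<alpha>) / 2) / \<bar>Im \<mu>\<bar>"
      by (simp add: add_divide_distrib mult_ac del: energy.simps)
    finally show "cmod (integral {0..x} (\<lambda>t. w \<mu> t $ i)) \<le> ((pi + ?E / min 1 \<alpha>) / 2) / \<bar>Im \<mu>\<bar>"
      using indefinite_integral_energy_bound[OF cw x e, of \<mu> i] by linarith
  qed
  have w_zero: "w \<mu> x = 0" if "x \<in> {0..pi}" for \<mu> x
  proof -
    have "w \<mu> x $ i = 0" for i
      by (rule continuous_eq_0_of_indefinite_integral_zero[OF _ pi_gt_zero int_w that])
        (intro continuous_intros cw)
    then show ?thesis by (simp add: vec_eq_iff)
  qed
  have z34: "z3 = 0" "z4 = 0"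
    using w_resolvent[of \<i>] w_zero[of 0 \<i>] w_zero[of pi \<i>] by (auto simp: U1_def U2_def)
  have "integral {0..x} (\<lambda>t. rhoJ t (z t)) = 0" if x: "x \<in> {0..pi}" for x
  proof -
    have "dirac 0 t (w 0 t) = 0" if "t \<in> {0..x}" for t
      using w_zero[of t 0] that x by (simp add: dirac_def rhoJ_def complex2_eq_iff)
    then have "integral {0..x} (\<lambda>t. dirac 0 t (w 0 t)) = 0"
      by (intro integral_unique has_integral_is_0) auto
    then show ?thesis
      using eq_w[OF x, of 0] w_zero[OF x] w0[of 0] w_zero[of 0 0] by (simp add: F_def)
  qed
  then obtain N where N: "negligible N" "\<And>x. x \<in> {0..pi} - N \<Longrightarrow> rhoJ x (z x) = 0"
    using indefinite_integral_zero_imp_ae_zero[OF rhoJ_integrable_L1[OF z]] by blast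
  have "z x = 0" if "x \<in> {0..pi} - N" for x
    using N(2)[OF that] rho_pos[of x] by (auto simp: rhoJ_def complex2_eq_iff)
  then have "AE x in lebesgue_on {0<..<pi}. z x = 0"
    using N(1) by (rule negligible_imp_AE_Ioo[rotated])
  then show ?thesis using z34 by simp
qed

end

text \<open>A zero of the characteristic function is an eigenvalue since \<open>\<phi>\<close> itself is an eigenfunction: it satisfies
  the first boundary condition for every \<open>\<mu>\<close>, and \<open>\<phi>(0, \<mu>) = 0\<close> would contradict \<open>k1 > 0\<close>.\<close>

theorem theorem7:
  fixes a \<alpha> b1 b2 b3 b4 c1 c2 c3 c4 k1 k2 :: real
    and p q :: "real \<Rightarrow> real"
    and \<phi> :: "real \<Rightarrow> complex \<Rightarrow> complex^2"
    and lam :: "int \<Rightarrow> complex"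
  assumes "0 < a" and "a < pi" and "0 < \<alpha>" and "\<alpha> \<noteq> 1"
    and "in_L2 p" and "in_L2 q"
    and "k1 = b1 * b4 - b2 * b3" and "k1 > 0"
    and "k2 = c1 * c4 - c2 * c3" and "k2 > 0"
    and "\<And>\<mu>. is_solution a \<alpha> p q \<mu> (\<lambda>x. \<phi> x \<mu>)"
    and "\<And>\<mu>. \<phi> 0 \<mu> = vector [\<mu> * complex_of_real b3 - complex_of_real b1,
                                 complex_of_real b2 - \<mu> * complex_of_real b4]"
    and "range lam = {\<mu>. is_eigenvalue a \<alpha> p q b1 b2 b3 b4 c1 c2 c3 c4 \<mu>}"
  shows "complete_system a \<alpha> k1 k2 (\<lambda>n. to_hspace b3 b4 c3 c4 (\<lambda>x. \<phi> x (lam n)))"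
proof -
  interpret dirac_bvp a \<alpha> p q b1 b2 b3 b4 c1 c2 c3 c4 k1 k2
    by unfold_locales (use assms(3,5-10) in auto)
  have nz: "\<phi> 0 \<mu> \<noteq> 0" for \<mu>
  proof
    assume "\<phi> 0 \<mu> = 0"
    then have "complex_of_real b3 * \<phi> 0 \<mu> $ 2 + b4 * \<phi> 0 \<mu> $ 1 = 0"
      by simp
    then have "complex_of_real (b1 * b4 - b2 * b3) = 0"
      by (simp add: assms(12) algebra_simps)
    then show False using assms(7,8) by (simp only: of_real_eq_0_iff)
  qed
  have eigen: "\<mu> \<in> range lam" if "U2 c1 c2 c3 c4 \<mu> (\<lambda>x. \<phi> x \<mu>) = 0" for \<mu>
  proof -
    have "U1 b1 b2 b3 b4 \<mu> (\<lambda>x. \<phi> x \<mu>) = 0"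
      by (simp add: U1_def assms(12) algebra_simps)
    moreover have "\<exists>x\<in>{0..pi}. \<phi> x \<mu> \<noteq> 0"
      using nz[of \<mu>] by (intro bexI[of _ 0]) auto
    ultimately show ?thesis
      unfolding assms(13) is_eigenvalue_def using assms(11)[of \<mu>] that by blast
  qed
  show ?thesis
    unfolding complete_system_def
  proof (intro conjI allI ballI impI)
    show "to_hspace b3 b4 c3 c4 (\<lambda>x. \<phi> x (lam n)) \<in> hspace a \<alpha>" for n
      unfolding to_hspace_def
      by (rule continuous_in_hspace[OF is_solution_imp_integral_equation(1)[OF assms(11)]])
    fix Z assume Z: "Z \<in> hspace a \<alpha>"
      and orth: "\<forall>n. hspace_inner a \<alpha> k1 k2 Z (to_hspace b3 b4 c3 c4 (\<lambda>x. \<phi> x (lam n))) = 0"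
    obtain z z3 z4 where Z_eq: "Z = (z, z3, z4)" by (metis prod_cases3)
    show "hspace_zero Z"
      unfolding Z_eq
    proof (rule orthogonal_to_eigenfunctions_imp_zero[where f = "\<lambda>\<mu> x. \<phi> x \<mu>", OF assms(11,12)])
      show "(z, z3, z4) \<in> hspace a \<alpha>" using Z Z_eq by simp
      show "hspace_inner a \<alpha> k1 k2 (z, z3, z4) (to_hspace b3 b4 c3 c4 (\<lambda>x. \<phi> x \<mu>)) = 0"
        if "U2 c1 c2 c3 c4 \<mu> (\<lambda>x. \<phi> x \<mu>) = 0" for \<mu>
        using orth eigen[OF that] Z_eq by auto
    qed
  qed
qed

end
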